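(* Let $X_1,\dots,X_r$ be Banach spaces with $M(X_i)>1$ for each $i=1,\dots,r$, and let $\|\cdot\|_\psi$ be an absolute normalized norm on $\mathbb{R}^r$ which is strictly monotone. Then the direct sum $(X_1\oplus\dots\oplus X_r)_\psi$ has the weak fixed point property.
   Context: For a Banach space $X$ and $a\ge0$, $R(a,X)=\sup\{\liminf_{n\to\infty}\|x_n+x\|\}$, the supremum taken over all $x\in X$ with $\|x\|\le a$ and all weakly null sequences $(x_n)$ in the unit ball $B_X$ with $\limsup_{n\to\infty}\limsup_{m\to\infty}\|x_n-x_m\|\le1$; $M(X)=\sup\{(1+a)/R(a,X):a\ge0\}$. A norm on $\mathbb{R}^r$ is absolute if $\|(x_1,\dots,x_r)\|=\|(|x_1|,\dots,|x_r|)\|$, normalized if standard unit vectors have norm 1, strictly monotone if $\|(x_i)\|<\|(y_i)\|$ whenever $|x_i|\le|y_i|$ for all $i$ with strict inequality for some $i$. $(X_1\oplus\dots\oplus X_r)_\psi$ is $X_1\times\dots\times X_r$ with norm $\|(x_1,\dots,x_r)\|_\psi=\|(\|x_1\|,\dots,\|x_r\|)\|_\psi$. A Banach space has the weak fixed point property (WFPP) if every nonexpansive mapping ($\|Tx-Ty\|\le\|x-y\|$) $T:C\to C$ on a nonempty weakly compact convex subset $C$ has a fixed point. *)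

theory Defs
  imports "HOL-Analysis.Analysis"
begin

text \<open>A normed space is given by a linear subspace V of a real vector space type
  together with a norm function N (only its values on V matter).
  All notions below are intrinsic to the pair (V, N).\<close>

definition dual_fun :: "'v::real_vector set \<Rightarrow> ('v \<Rightarrow> real) \<Rightarrow> ('v \<Rightarrow> real) set" where
  "dual_fun V N = {f. (\<forall>x\<in>V. \<forall>y\<in>V. f (x + y) = f x + f y)
                    \<and> (\<forall>c. \<forall>x\<in>V. f (c *\<^sub>R x) = c * f x)
                    \<and> (\<exists>K. \<forall>x\<in>V. \<bar>f x\<bar> \<le> K * N x)}"

definition weak_top :: "'v::real_vector set \<Rightarrow> ('v \<Rightarrow> real) \<Rightarrow> 'v topology" where
  "weak_top V N = subtopology
     (topology_generated_by {{x. f x \<in> U} | f U. f \<in> dual_fun V N \<and> open U}) V"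

definition weakly_compact :: "'v::real_vector set \<Rightarrow> ('v \<Rightarrow> real) \<Rightarrow> 'v set \<Rightarrow> bool" where
  "weakly_compact V N C \<longleftrightarrow> C \<subseteq> V \<and> compactin (weak_top V N) C"

definition weakly_null :: "'v::real_vector set \<Rightarrow> ('v \<Rightarrow> real) \<Rightarrow> (nat \<Rightarrow> 'v) \<Rightarrow> bool" where
  "weakly_null V N xs \<longleftrightarrow> (\<forall>n. xs n \<in> V) \<and>
     (\<forall>f\<in>dual_fun V N. (\<lambda>n. f (xs n)) \<longlonglongrightarrow> 0)"

definition nonexpansive_on :: "'v::real_vector set \<Rightarrow> ('v \<Rightarrow> real) \<Rightarrow> ('v \<Rightarrow> 'v) \<Rightarrow> bool" where
  "nonexpansive_on C N T \<longleftrightarrow> (\<forall>x\<in>C. \<forall>y\<in>C. N (T x - T y) \<le> N (x - y))"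

definition WFPP :: "'v::real_vector set \<Rightarrow> ('v \<Rightarrow> real) \<Rightarrow> bool" where
  "WFPP V N \<longleftrightarrow> (\<forall>C T. C \<noteq> {} \<and> convex C \<and> weakly_compact V N C
        \<and> T ` C \<subseteq> C \<and> nonexpansive_on C N T \<longrightarrow> (\<exists>x\<in>C. T x = x))"

definition R_const :: "real \<Rightarrow> 'v::real_vector set \<Rightarrow> ('v \<Rightarrow> real) \<Rightarrow> ereal" where
  "R_const a V N = (SUP p \<in> {(x, xs). x \<in> V \<and> N x \<le> a \<and> weakly_null V N xs
        \<and> (\<forall>n. N (xs n) \<le> 1)
        \<and> Limsup sequentially (\<lambda>n. Limsup sequentially (\<lambda>m. ereal (N (xs n - xs m)))) \<le> 1}.
        Liminf sequentially (\<lambda>n. ereal (N (snd p n + fst p))))"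

definition M_const :: "'v::real_vector set \<Rightarrow> ('v \<Rightarrow> real) \<Rightarrow> ereal" where
  "M_const V N = (SUP a \<in> {0..}. ereal (1 + a) / R_const a V N)"

definition is_norm_on_Rn :: "(real^'n::finite \<Rightarrow> real) \<Rightarrow> bool" where
  "is_norm_on_Rn \<psi> \<longleftrightarrow> (\<forall>x. 0 \<le> \<psi> x) \<and> (\<forall>x. \<psi> x = 0 \<longleftrightarrow> x = 0)
     \<and> (\<forall>c x. \<psi> (c *\<^sub>R x) = \<bar>c\<bar> * \<psi> x) \<and> (\<forall>x y. \<psi> (x + y) \<le> \<psi> x + \<psi> y)"

definition absolute_norm :: "(real^'n::finite \<Rightarrow> real) \<Rightarrow> bool" where
  "absolute_norm \<psi> \<longleftrightarrow> (\<forall>x. \<psi> x = \<psi> (\<chi> i. \<bar>x $ i\<bar>))"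

definition normalized_norm :: "(real^'n::finite \<Rightarrow> real) \<Rightarrow> bool" where
  "normalized_norm \<psi> \<longleftrightarrow> (\<forall>i. \<psi> (axis i 1) = 1)"

definition strictly_monotone_norm :: "(real^'n::finite \<Rightarrow> real) \<Rightarrow> bool" where
  "strictly_monotone_norm \<psi> \<longleftrightarrow> (\<forall>x y. (\<forall>i. \<bar>x $ i\<bar> \<le> \<bar>y $ i\<bar>) \<and> (\<exists>i. \<bar>x $ i\<bar> < \<bar>y $ i\<bar>)
      \<longrightarrow> \<psi> x < \<psi> y)"

text \<open>The psi-direct sum of the spaces X_i = (S i, norm), realised inside 'a^'n.\<close>
definition psi_sum_carrier :: "('n::finite \<Rightarrow> 'a::real_normed_vector set) \<Rightarrow> ('a^'n) set" where
  "psi_sum_carrier S = {x. \<forall>i. x $ i \<in> S i}"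

definition psi_sum_norm :: "(real^'n::finite \<Rightarrow> real) \<Rightarrow> ('a::real_normed_vector^'n) \<Rightarrow> real" where
  "psi_sum_norm \<psi> x = \<psi> (\<chi> i. norm (x $ i))"

end

theory Submission
  imports Defs "HOL-Library.Diagonal_Subsequence"
begin

text \<open>Suppose \<open>T\<close> has no fixed point and let \<open>K\<close> be a minimal invariant set, of diameter
  \<open>d > 0\<close>, with an approximate fixed point sequence \<open>x\<^sub>n\<close> converging weakly to \<open>p \<in> K\<close>. For
  \<open>0 < \<tau> < d\<close>, starting from \<open>p + (\<tau>/d) (x\<^sub>n - p)\<close> and iterating averages of \<open>T\<close> gives almost
  fixed points \<open>z\<^sub>n\<close>, weakly convergent to some \<open>u\<close>, with \<open>\<parallel>z\<^sub>n - z\<^sub>m\<parallel> \<le> \<tau>\<close> and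
  \<open>\<parallel>z\<^sub>n - x\<^sub>n\<parallel> \<le> d - \<tau>\<close> up to a small error; by the Goebel--Karlovitz lemma \<open>\<parallel>z\<^sub>n - p\<parallel>\<close> is almost \<open>d\<close>.
  In the limit the componentwise quantities \<open>\<delta>\<^sub>i = lim lim \<parallel>z\<^sub>n\<^sup>i - z\<^sub>m\<^sup>i\<parallel>\<close>, \<open>\<zeta>\<^sub>i = \<parallel>u\<^sup>i - p\<^sup>i\<parallel>\<close>,
  \<open>\<eta>\<^sub>i = lim \<parallel>z\<^sub>n\<^sup>i - x\<^sub>n\<^sup>i\<parallel>\<close> and \<open>e\<^sub>i = lim \<parallel>z\<^sub>n\<^sup>i - p\<^sup>i\<parallel>\<close> satisfy \<open>e \<le> \<delta> + \<zeta>\<close>, \<open>\<zeta> \<le> \<eta>\<close>,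
  \<open>\<psi> \<delta> \<le> \<tau>\<close>, \<open>\<psi> \<eta> \<le> d - \<tau>\<close>, \<open>\<psi> e \<ge> d\<close>, so strict monotonicity forces \<open>e = \<delta> + \<zeta>\<close> and
  \<open>\<zeta> = \<eta>\<close>. Since \<open>M(X\<^sub>i) > 1\<close>, the equality \<open>e\<^sub>i = \<delta>\<^sub>i + \<zeta>\<^sub>i\<close> is only possible if \<open>\<delta>\<^sub>i = 0\<close> or
  \<open>\<zeta>\<^sub>i = 0\<close>; in the latter case \<open>z\<^sub>n\<^sup>i - x\<^sub>n\<^sup>i\<close> tends to \<open>0\<close> and \<open>\<delta>\<^sub>i = c\<^sub>i := lim \<parallel>x\<^sub>n\<^sup>i - p\<^sup>i\<parallel>\<close>. Hence
  \<open>\<tau> = \<psi> \<delta>\<close> is the norm of a restriction of \<open>c\<close> to a subset of the coordinates. There are only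
  finitely many such values, and \<open>\<tau>\<close> can be chosen to avoid them.\<close>

section \<open>The Hahn--Banach theorem and weak convergence\<close>

text \<open>An inequality for positive factors suffices: applying it again with \<open>1 / c\<close>
  turns it into an equality, and the factor 2 gives \<open>p 0 = 0\<close>.\<close>

definition sublinear :: "('v::real_vector \<Rightarrow> real) \<Rightarrow> bool" where
  "sublinear p \<longleftrightarrow> (\<forall>x y. p (x + y) \<le> p x + p y) \<and> (\<forall>c>0. \<forall>x. p (c *\<^sub>R x) \<le> c * p x)"

lemma sublinear_add: "sublinear p \<Longrightarrow> p (x + y) \<le> p x + p y"
  by (simp add: sublinear_def)

lemma sublinear_scale:
  assumes "sublinear p" "c > 0"
  shows "p (c *\<^sub>R x) = c * p x"
proof (rule antisym)
  show "p (c *\<^sub>R x) \<le> c * p x"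
    using assms by (simp add: sublinear_def)
  have "p ((1 / c) *\<^sub>R (c *\<^sub>R x)) \<le> (1 / c) * p (c *\<^sub>R x)"
    using assms unfolding sublinear_def by (meson zero_less_divide_1_iff)
  then show "c * p x \<le> p (c *\<^sub>R x)"
    using assms(2) by (simp add: field_simps)
qed

lemma sublinear_zero:
  assumes "sublinear p" shows "p 0 = 0"
  using sublinear_scale[OF assms, of 2 0] by simp

lemma sublinear_minus:
  assumes "sublinear p" shows "- p (- x) \<le> p x"
  using sublinear_add[OF assms, of x "- x"] sublinear_zero[OF assms] by simp

text \<open>A minimal sublinear functional \<open>q\<close> is linear: \<open>x \<mapsto> inf\<^sub>t (q (x + t y) - t q y)\<close> is
  sublinear, lies below \<open>q\<close>, and takes a value at most \<open>- q y\<close> at \<open>- y\<close>.\<close>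

lemma minimal_sublinear_linear:
  assumes q: "sublinear q" and min: "\<And>r. sublinear r \<Longrightarrow> (\<And>x. r x \<le> q x) \<Longrightarrow> r = q"
  shows "linear q"
proof -
  have odd: "q (- y) = - q y" for y
  proof -
    define r where "r = (\<lambda>x. INF t\<in>{0..}. q (x + t *\<^sub>R y) - t * q y)"
    have scale: "q (t *\<^sub>R y) = t * q y" if "t \<ge> 0" for t
      using sublinear_scale[OF q, of t y] sublinear_zero[OF q] that by (cases "t = 0") auto
    have bdd: "bdd_below ((\<lambda>t. q (x + t *\<^sub>R y) - t * q y) ` {0..})" for x
    proof (rule bdd_belowI2[where m = "- q (- x)"])
      fix t :: real assume "t \<in> {0..}"
      then have "t * q y = q ((x + t *\<^sub>R y) + - x)"
        using scale[of t] by simp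
      also have "\<dots> \<le> q (x + t *\<^sub>R y) + q (- x)"
        by (rule sublinear_add[OF q])
      finally show "- q (- x) \<le> q (x + t *\<^sub>R y) - t * q y" by simp
    qed
    have r_le: "r x \<le> q (x + t *\<^sub>R y) - t * q y" if "t \<ge> 0" for x t
      unfolding r_def using that by (intro cINF_lower bdd) auto
    have r_ge: "c \<le> r x" if "\<And>t. t \<ge> 0 \<Longrightarrow> c \<le> q (x + t *\<^sub>R y) - t * q y" for c x
      unfolding r_def using that by (intro cINF_greatest) auto
    have "r (x + z) \<le> r x + r z" for x z
    proof -
      have "r (x + z) - r z \<le> r x"
      proof (rule r_ge)
        fix t :: real assume t: "t \<ge> 0"
        have "r (x + z) - (q (x + t *\<^sub>R y) - t * q y) \<le> r z"
        proof (rule r_ge)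
          fix s :: real assume s: "s \<ge> 0"
          \<comment> \<open>Parameters add up: \<open>t\<close> used for \<open>x\<close> and
            \<open>s\<close> used for \<open>z\<close> are compared with the single parameter
            \<open>t + s\<close> for \<open>x + z\<close>.\<close>
          have "r (x + z) \<le> q ((x + t *\<^sub>R y) + (z + s *\<^sub>R y)) - (t + s) * q y"
            using r_le[of "t + s" "x + z"] s t by (simp add: algebra_simps)
          then show "r (x + z) - (q (x + t *\<^sub>R y) - t * q y) \<le> q (z + s *\<^sub>R y) - s * q y"
            using sublinear_add[OF q, of "x + t *\<^sub>R y" "z + s *\<^sub>R y"] by (simp add: algebra_simps)
        qed
        then show "r (x + z) - r z \<le> q (x + t *\<^sub>R y) - t * q y" by simp
      qed
      then show ?thesis by simp
    qed
    moreover have "r (c *\<^sub>R x) \<le> c * r x" if c: "c > 0" for c x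
    proof -
      have "r (c *\<^sub>R x) / c \<le> r x"
      proof (rule r_ge)
        fix t :: real assume t: "t \<ge> 0"
        have "r (c *\<^sub>R x) \<le> q (c *\<^sub>R (x + t *\<^sub>R y)) - c * t * q y"
          using r_le[of "c * t" "c *\<^sub>R x"] c t by (simp add: algebra_simps)
        then show "r (c *\<^sub>R x) / c \<le> q (x + t *\<^sub>R y) - t * q y"
          using sublinear_scale[OF q c, of "x + t *\<^sub>R y"] c by (simp add: field_simps)
      qed
      then show ?thesis using c by (simp add: field_simps)
    qed
    ultimately have "sublinear r" by (simp add: sublinear_def)
    then have "r = q" using r_le[of 0] by (intro min) auto
    then have "q (- y) \<le> - q y"
      using r_le[of 1 "- y"] sublinear_zero[OF q] by simp
    then show ?thesis using sublinear_minus[OF q, of "- y"] by simp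
  qed
  show ?thesis
  proof (rule linearI)
    fix x y show "q (x + y) = q x + q y"
      using sublinear_add[OF q, of x y] sublinear_add[OF q, of "- x" "- y"] odd[of x] odd[of y]
        odd[of "x + y"] by simp
  next
    fix c :: real and x
    consider "c > 0" | "c = 0" | "c < 0" by linarith
    then show "q (c *\<^sub>R x) = c *\<^sub>R q x"
    proof cases
      case 3
      then show ?thesis using sublinear_scale[OF q, of "- c" x] odd[of "c *\<^sub>R x"] by simp
    qed (use sublinear_scale[OF q] sublinear_zero[OF q] in auto)
  qed
qed

text \<open>Zorn's lemma for the reversed pointwise order gives a minimal sublinear functional below
  \<open>p\<close>. Anything sublinear below it is again below \<open>p\<close>, so it is minimal
  among all sublinear functionals and hence linear.\<close>

lemma hahn_banach_sublinear:
  assumes p: "sublinear p"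
  shows "\<exists>f. linear f \<and> (\<forall>x. f x \<le> p x)"
proof -
  define A where "A = {q. sublinear q \<and> (\<forall>x. q x \<le> p x)}"
  define P where "P = (\<lambda>q r :: 'a \<Rightarrow> real. \<forall>x. r x \<le> q x)"
  have "\<exists>m\<in>A. \<forall>a\<in>A. P m a \<longrightarrow> a = m"
  proof (rule predicate_Zorn)
    show "partial_order_on A (relation_of P A)"
    proof (rule partial_order_on_relation_ofI)
      show "P a c" if "P a b" "P b c" for a b c
        using that unfolding P_def by (meson order_trans)
      show "a = b" if "P a b" "P b a" for a b
        using that unfolding P_def by (intro ext antisym) auto
    qed (simp add: P_def)
  next
    fix C assume C: "C \<in> Chains (relation_of P A)"
    have CA: "q \<in> A" if "q \<in> C" for q
      using C that by (auto simp: Chains_def relation_of_def)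
    have tot: "P q r \<or> P r q" if "q \<in> C" "r \<in> C" for q r
      using C that by (auto simp: Chains_def relation_of_def)
    show "\<exists>u\<in>A. \<forall>a\<in>C. P a u"
    proof (cases "C = {}")
      case True
      then show ?thesis using p by (auto simp: A_def)
    next
      case False
      define u where "u = (\<lambda>x. INF q\<in>C. q x)"
      have bdd: "bdd_below ((\<lambda>q. q x) ` C)" for x
      proof (rule bdd_belowI2[where m = "- p (- x)"])
        fix q assume "q \<in> C"
        then have "sublinear q" "q (- x) \<le> p (- x)" using CA by (auto simp: A_def)
        then show "- p (- x) \<le> q x" using sublinear_minus[of q x] by linarith
      qed
      have u_le: "u x \<le> q x" if "q \<in> C" for q x
        unfolding u_def using that by (intro cINF_lower bdd)
      have u_ge: "c \<le> u x" if "\<And>q. q \<in> C \<Longrightarrow> c \<le> q x" for c x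
        unfolding u_def using that False by (intro cINF_greatest) auto
      have "u (x + z) \<le> u x + u z" for x z
      proof -
        have "u (x + z) - u z \<le> u x"
        proof (rule u_ge)
          fix q assume q: "q \<in> C"
          have "u (x + z) - q x \<le> u z"
          proof (rule u_ge)
            fix r assume r: "r \<in> C"
            \<comment> \<open>Of two members of the chain one lies below the other, so a single
              \<open>s\<close> serves for \<open>q\<close> at \<open>x\<close> and for
              \<open>r\<close> at \<open>z\<close>.\<close>
            obtain s where s: "s \<in> C" "s x \<le> q x" "s z \<le> r z"
              using tot[OF q r] q r by (auto simp: P_def)
            have "s (x + z) \<le> s x + s z"
              using CA[OF s(1)] by (simp add: A_def sublinear_add)
            then show "u (x + z) - q x \<le> r z"
              using s u_le[OF s(1), of "x + z"] by linarith
          qed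
          then show "u (x + z) - u z \<le> q x" by simp
        qed
        then show ?thesis by simp
      qed
      moreover have "u (c *\<^sub>R x) \<le> c * u x" if c: "c > 0" for c x
      proof -
        have "u (c *\<^sub>R x) / c \<le> u x"
        proof (rule u_ge)
          fix q assume q: "q \<in> C"
          then have "u (c *\<^sub>R x) \<le> c * q x"
            using u_le[OF q, of "c *\<^sub>R x"] CA[OF q] c by (simp add: A_def sublinear_scale)
          then show "u (c *\<^sub>R x) / c \<le> q x" using c by (simp add: field_simps)
        qed
        then show ?thesis using c by (simp add: field_simps)
      qed
      moreover have "u x \<le> p x" for x
      proof -
        obtain q where "q \<in> C" using False by blast
        then show ?thesis using CA[of q] u_le[of q x] by (auto simp: A_def intro: order_trans)
      qed
      ultimately have "u \<in> A" by (simp add: A_def sublinear_def)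
      then show ?thesis using u_le by (auto simp: P_def)
    qed
  qed
  then obtain m where m: "m \<in> A" "\<And>a. a \<in> A \<Longrightarrow> P m a \<Longrightarrow> a = m" by blast
  have "linear m"
  proof (rule minimal_sublinear_linear)
    show "sublinear m" using m by (simp add: A_def)
    show "r = m" if "sublinear r" "\<And>x. r x \<le> m x" for r
    proof (rule m(2))
      have "r x \<le> p x" for x
        using that(2)[of x] m(1) by (auto simp: A_def intro: order_trans)
      then show "r \<in> A" using that(1) by (simp add: A_def)
      show "P m r" using that(2) by (simp add: P_def)
    qed
  qed
  then show ?thesis using m by (auto simp: A_def)
qed

section \<open>Norms given as functions: separation of convex sets and weak convergence\<close>

locale norm_fun =
  fixes N :: "'v::real_vector \<Rightarrow> real"
  assumes N_triangle: "N (x + y) \<le> N x + N y"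
    and N_scaleR: "N (c *\<^sub>R x) = \<bar>c\<bar> * N x"
    and N_eq_0: "N x = 0 \<Longrightarrow> x = 0"
begin

lemma N_zero [simp]: "N 0 = 0"
  using N_scaleR[of 0 0] by simp

lemma N_minus [simp]: "N (- x) = N x"
  using N_scaleR[of "- 1" x] by simp

lemma N_minus_commute: "N (x - y) = N (y - x)"
  using N_minus[of "x - y"] by simp

lemma N_nonneg [simp]: "0 \<le> N x"
  using N_triangle[of x "- x"] by simp

lemma N_triangle_sub: "N (x - z) \<le> N (x - y) + N (y - z)"
  using N_triangle[of "x - y" "y - z"] by simp

lemma N_diff: "N (x - y) \<le> N x + N y"
  using N_triangle[of x "- y"] by simp

lemma N_reverse: "N x - N y \<le> N (x - y)"
  using N_triangle[of "x - y" y] by simp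

lemma N_convex:
  assumes "0 \<le> u" "0 \<le> v" "N x \<le> a" "N y \<le> b"
  shows "N (u *\<^sub>R x + v *\<^sub>R y) \<le> u * a + v * b"
proof -
  have "N (u *\<^sub>R x + v *\<^sub>R y) \<le> u * N x + v * N y"
    using N_triangle[of "u *\<^sub>R x" "v *\<^sub>R y"] assms by (simp add: N_scaleR)
  also have "\<dots> \<le> u * a + v * b"
    using assms by (intro add_mono mult_left_mono) auto
  finally show ?thesis .
qed

lemma linear_le_abs:
  assumes "linear f" "\<And>x. f x \<le> N x"
  shows "\<bar>f x\<bar> \<le> N x"
  using assms(2)[of x] assms(2)[of "- x"] linear_neg[OF assms(1), of x] by auto

lemma dual_funI:
  assumes "linear f" "\<And>x. \<bar>f x\<bar> \<le> K * N x"
  shows "f \<in> dual_fun V N"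
  using assms by (auto simp: dual_fun_def linear_add linear_scale)

text \<open>\<open>N\<close> is a norm on the whole type, whereas \<open>dual_fun V N\<close> tests
  only \<open>V\<close>. Functionals are therefore built on the whole type and belong to the dual of
  every \<open>V\<close>.\<close>

lemma dual_funI1:
  assumes "linear f" "\<And>x. f x \<le> N x"
  shows "f \<in> dual_fun V N"
  using linear_le_abs[OF assms] assms(1) by (intro dual_funI[where K = 1]) auto

text \<open>Hahn--Banach is applied to the infimum \<open>P v\<close> of
  \<open>N (v - h (a - p)) - h r\<close> over \<open>h \<ge> 0\<close> and \<open>a \<in> A\<close>.
  The choice \<open>h = 0\<close> gives \<open>P \<le> N\<close>, and \<open>h = 1\<close> gives
  \<open>P (a - p) \<le> - r\<close>, the required gap.\<close>

lemma separation:
  assumes A: "convex A" "A \<noteq> {}" and r: "0 \<le> r" "\<And>a. a \<in> A \<Longrightarrow> r \<le> N (a - p)"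
  shows "\<exists>f. linear f \<and> (\<forall>x. f x \<le> N x) \<and> (\<forall>a\<in>A. f a + r \<le> f p)"
proof -
  define I where "I = {0::real..} \<times> A"
  define F where "F = (\<lambda>v (h, a). N (v - h *\<^sub>R (a - p)) - h * r)"
  define P where "P = (\<lambda>v. INF i\<in>I. F v i)"
  have I: "I \<noteq> {}" using A by (auto simp: I_def)
  \<comment> \<open>The distance hypothesis makes \<open>h r\<close> at most
    \<open>N (h (a - p))\<close>, so the infimum stays finite.\<close>
  have F_ge: "- N v \<le> F v i" if "i \<in> I" for v i
  proof -
    obtain h a where i: "i = (h, a)" "h \<ge> 0" "a \<in> A"
      using \<open>i \<in> I\<close> unfolding I_def by blast
    have "N (h *\<^sub>R (a - p)) - N v \<le> N (v - h *\<^sub>R (a - p))"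
      using N_reverse[of "h *\<^sub>R (a - p)" v] by (simp add: N_minus_commute)
    moreover have "h * r \<le> N (h *\<^sub>R (a - p))"
      using i r by (simp add: N_scaleR mult_left_mono)
    ultimately show ?thesis by (simp add: F_def i(1))
  qed
  have P_le: "P v \<le> F v i" if "i \<in> I" for v i
    unfolding P_def using that F_ge by (intro cINF_lower bdd_belowI2) auto
  have P_ge: "c \<le> P v" if "\<And>i. i \<in> I \<Longrightarrow> c \<le> F v i" for c v
    unfolding P_def using that I by (intro cINF_greatest)
  have "P (v + w) \<le> P v + P w" for v w
  proof -
    have key: "P (v + w) \<le> F v i + F w j" if ij: "i \<in> I" "j \<in> I" for i j
    proof -
      obtain h a k b where i: "i = (h, a)" "h \<ge> 0" "a \<in> A" and j: "j = (k, b)" "k \<ge> 0" "b \<in> A"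
        using ij unfolding I_def by blast
      show ?thesis
      proof (cases "h + k = 0")
        case True
        then have "h = 0" "k = 0" using i j by auto
        moreover have "P (v + w) \<le> N (v + w)"
          using P_le[of "(0, a)" "v + w"] i by (simp add: F_def I_def)
        ultimately show ?thesis using N_triangle[of v w] by (simp add: F_def i j)
      next
        case False
        \<comment> \<open>Convexity enters here: the two multiples of points of \<open>A\<close>
          combine into \<open>h + k\<close> times one point of \<open>A\<close>.\<close>
        define c where "c = (h / (h + k)) *\<^sub>R a + (k / (h + k)) *\<^sub>R b"
        have hk: "h + k > 0" using False i j by linarith
        have "c \<in> A"
          unfolding c_def using i j hk A(1)
          by (intro convexD) (auto simp flip: add_divide_distrib)
        then have "P (v + w) \<le> F (v + w) (h + k, c)"
          using i j by (intro P_le) (auto simp: I_def)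
        also have "(h + k) *\<^sub>R c = h *\<^sub>R a + k *\<^sub>R b"
          using hk by (simp add: c_def scaleR_add_right)
        then have "(h + k) *\<^sub>R (c - p) = h *\<^sub>R (a - p) + k *\<^sub>R (b - p)"
          by (simp add: algebra_simps)
        then have "F (v + w) (h + k, c)
            = N ((v - h *\<^sub>R (a - p)) + (w - k *\<^sub>R (b - p))) - (h + k) * r"
          by (simp add: F_def algebra_simps)
        also have "\<dots> \<le> F v i + F w j"
          using N_triangle[of "v - h *\<^sub>R (a - p)" "w - k *\<^sub>R (b - p)"]
          by (simp add: F_def i j algebra_simps)
        finally show ?thesis .
      qed
    qed
    have "P (v + w) - P w \<le> P v"
    proof (rule P_ge)
      fix i assume i: "i \<in> I"
      have "P (v + w) - F v i \<le> P w"
        using key[OF i] by (intro P_ge) (simp add: algebra_simps)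
      then show "P (v + w) - P w \<le> F v i" by simp
    qed
    then show ?thesis by simp
  qed
  moreover have "P (c *\<^sub>R v) \<le> c * P v" if c: "c > 0" for c v
  proof -
    have "P (c *\<^sub>R v) / c \<le> P v"
    proof (rule P_ge)
      fix i assume "i \<in> I"
      then obtain h a where i: "i = (h, a)" "h \<ge> 0" "a \<in> A"
        unfolding I_def by blast
      have "P (c *\<^sub>R v) \<le> F (c *\<^sub>R v) (c * h, a)"
        using i c by (intro P_le) (auto simp: I_def)
      also have "\<dots> = N (c *\<^sub>R (v - h *\<^sub>R (a - p))) - c * h * r"
        by (simp add: F_def algebra_simps)
      also have "\<dots> = c * F v i"
        using c unfolding N_scaleR by (simp add: F_def i algebra_simps)
      finally show "P (c *\<^sub>R v) / c \<le> F v i" using c by (simp add: field_simps)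
    qed
    then show ?thesis using c by (simp add: field_simps)
  qed
  ultimately have "sublinear P" by (simp add: sublinear_def)
  then obtain f where f: "linear f" "\<And>x. f x \<le> P x"
    using hahn_banach_sublinear by blast
  obtain a0 where "a0 \<in> A" using A by auto
  have "f x \<le> N x" for x
    using f(2)[of x] P_le[of "(0, a0)" x] \<open>a0 \<in> A\<close> by (simp add: F_def I_def)
  moreover have "f a + r \<le> f p" if "a \<in> A" for a
    using f(2)[of "a - p"] P_le[of "(1, a)" "a - p"] that linear_diff[OF f(1), of a p]
    by (simp add: F_def I_def)
  ultimately show ?thesis using f(1) by blast
qed

text \<open>The point \<open>v\<close> is separated from the origin with gap
  \<open>N v\<close>.\<close>

lemma norming_functional: "\<exists>f. linear f \<and> (\<forall>x. f x \<le> N x) \<and> f v = N v"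
proof -
  obtain f where f: "linear f" "\<And>x. f x \<le> N x" "f 0 + N v \<le> f v"
    using separation[of "{0}" "N v" v] by auto
  then have "f v = N v" using f(2)[of v] linear_0[OF f(1)] by simp
  then show ?thesis using f by blast
qed

text \<open>Stated with \<open>f (z n)\<close> and \<open>f u\<close> rather than with differences,
  because a member of \<open>dual_fun V N\<close> is only known to be additive on
  \<open>V\<close>.\<close>

definition wconv :: "'v set \<Rightarrow> (nat \<Rightarrow> 'v) \<Rightarrow> 'v \<Rightarrow> bool" where
  "wconv V z u \<longleftrightarrow> (\<forall>f\<in>dual_fun V N. (\<lambda>n. f (z n)) \<longlonglongrightarrow> f u)"

lemma wconv_const: "wconv V (\<lambda>_. y) y"
  by (simp add: wconv_def)

text \<open>Weak lower semicontinuity of the norm: a functional norming \<open>u - y\<close> carries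
  the bound on the terms over to the limit.\<close>

lemma wconv_dist_le:
  assumes "wconv V z u" "wconv V x y" "\<forall>\<^sub>F n in sequentially. N (z n - x n) \<le> b"
  shows "N (u - y) \<le> b"
proof -
  obtain f where f: "linear f" "\<And>x. f x \<le> N x" "f (u - y) = N (u - y)"
    using norming_functional[of "u - y"] by blast
  have "f \<in> dual_fun V N" using f by (intro dual_funI1)
  then have "(\<lambda>n. f (z n)) \<longlonglongrightarrow> f u" "(\<lambda>n. f (x n)) \<longlonglongrightarrow> f y"
    using assms(1,2) by (simp_all add: wconv_def)
  then have "(\<lambda>n. f (z n - x n)) \<longlonglongrightarrow> f (u - y)"
    unfolding linear_diff[OF f(1)] by (intro tendsto_intros)
  moreover have "\<forall>\<^sub>F n in sequentially. f (z n - x n) \<le> b"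
    using assms(3) by eventually_elim (use f(2) order_trans in blast)
  ultimately have "f (u - y) \<le> b"
    by (intro tendsto_upperbound[of _ _ sequentially]) auto
  then show ?thesis using f by simp
qed

lemma dual_fun_diff:
  assumes "f \<in> dual_fun V N" "subspace V" "x \<in> V" "y \<in> V"
  shows "f (x - y) = f x - f y"
proof -
  have "(- 1) *\<^sub>R y \<in> V" using assms by (intro subspace_scale)
  then have "f (x + (- 1) *\<^sub>R y) = f x + f ((- 1) *\<^sub>R y)"
    using assms unfolding dual_fun_def by blast
  also have "f ((- 1) *\<^sub>R y) = - 1 * f y"
    using assms unfolding dual_fun_def by blast
  finally show ?thesis by simp
qed

lemma wconv_diff_const:
  assumes "wconv V z u" "subspace V" "\<And>n. z n \<in> V" "u \<in> V" "p \<in> V"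
  shows "wconv V (\<lambda>n. z n - p) (u - p)"
  unfolding wconv_def
proof
  fix f assume f: "f \<in> dual_fun V N"
  have "(\<lambda>n. f (z n) - f p) \<longlonglongrightarrow> f u - f p"
    using assms(1) f by (intro tendsto_intros) (simp add: wconv_def)
  then show "(\<lambda>n. f (z n - p)) \<longlonglongrightarrow> f (u - p)"
    using assms by (simp add: dual_fun_diff[OF f])
qed

lemma wconv_subseq:
  assumes "wconv V z u" "strict_mono \<sigma>"
  shows "wconv V (z \<circ> \<sigma>) u"
  using assms LIMSEQ_subseq_LIMSEQ[OF _ assms(2)] unfolding wconv_def comp_def by blast

end

section \<open>Weakly compact convex sets\<close>

lemma diagonal_convergent:
  fixes a :: "nat \<Rightarrow> nat \<Rightarrow> 'a::euclidean_space"
  assumes "\<And>j. bounded (range (a j))"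
  shows "\<exists>\<sigma>::nat \<Rightarrow> nat. strict_mono \<sigma> \<and> (\<forall>j. convergent (\<lambda>n. a j (\<sigma> n)))"
proof -
  interpret subseqs "\<lambda>j s. convergent (\<lambda>n. a j (s n))"
  proof
    fix n and s :: "nat \<Rightarrow> nat" assume "strict_mono s"
    have "bounded (range (\<lambda>i. a n (s i)))"
      by (rule bounded_subset[OF assms[of n]]) auto
    then obtain l r where "strict_mono r" "((\<lambda>i. a n (s i)) \<circ> r) \<longlonglongrightarrow> l"
      using bounded_imp_convergent_subsequence by blast
    then show "\<exists>r'. strict_mono r' \<and> convergent (\<lambda>i. a n ((s \<circ> r') i))"
      unfolding convergent_def comp_def by blast
  qed
  have "convergent (\<lambda>n. a k (diagseq n))" for k
  proof -
    \<comment> \<open>From index \<open>Suc k\<close> on, the diagonal is a subsequence of one along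
      which \<open>a k\<close> converges; the omitted beginning does not affect convergence.\<close>
    have "convergent (\<lambda>n. a k ((diagseq \<circ> (+) (Suc k)) n))"
    proof (rule diagseq_holds)
      fix r s :: "nat \<Rightarrow> nat" and n
      assume "strict_mono r" "convergent (\<lambda>i. a n (s i))"
      then show "convergent (\<lambda>i. a n ((s \<circ> r) i))"
        using convergent_subseq_convergent[of "\<lambda>i. a n (s i)" r] by (simp add: comp_def)
    qed
    then show ?thesis
      using convergent_ignore_initial_segment[of "\<lambda>n. a k (diagseq n)" "Suc k"] by (simp add: add.commute)
  qed
  then show ?thesis using subseq_diagseq by blast
qed

locale weakly_compact_set = norm_fun N for N :: "'v::real_vector \<Rightarrow> real" +
  fixes V C :: "'v set"
  assumes weakly_compact: "weakly_compact V N C" and convex_C: "convex C"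
begin

definition W :: "'v topology" where "W = subtopology (weak_top V N) C"

lemma C_subset: "C \<subseteq> V"
  using weakly_compact by (simp add: weakly_compact_def)

lemma compact_space_W: "compact_space W"
  using weakly_compact by (simp add: weakly_compact_def W_def compactin_subspace)

lemma topspace_W: "topspace W = C"
  using weakly_compact unfolding weakly_compact_def W_def compactin_subspace by auto

lemma closedin_W_functional:
  assumes f: "f \<in> dual_fun V N" and "closed F"
  shows "closedin W {x \<in> C. f x \<in> F}"
proof -
  have "openin (topology_generated_by {{x. f x \<in> U} | f U. f \<in> dual_fun V N \<and> open U}) {x. f x \<in> - F}"
    using assms by (intro topology_generated_by_Basis CollectI exI[of _ f] exI[of _ "- F"]) auto
  then have "openin W (({x. f x \<in> - F} \<inter> V) \<inter> C)"
    unfolding W_def weak_top_def openin_subtopology by blast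
  also have "({x. f x \<in> - F} \<inter> V) \<inter> C = topspace W - {x \<in> C. f x \<in> F}"
    using C_subset by (auto simp: topspace_W)
  finally show ?thesis by (auto simp: closedin_def topspace_W)
qed

text \<open>Mazur's theorem, with \<open>cl\<close> expressing norm closedness relative to
  \<open>C\<close>. A point outside \<open>A\<close> has positive distance from \<open>A\<close>,
  and a separating functional yields a weakly open neighbourhood that misses
  \<open>A\<close>.\<close>

lemma closedin_W_convex:
  assumes A: "convex A" "A \<subseteq> C"
    and cl: "\<And>p. p \<in> C \<Longrightarrow> (\<And>e. e > 0 \<Longrightarrow> \<exists>a\<in>A. N (a - p) < e) \<Longrightarrow> p \<in> A"
  shows "closedin W A"
proof (cases "A = {}")
  case False
  have "openin W (C - A)"
  proof (subst openin_subopen, intro ballI)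
    fix p assume p: "p \<in> C - A"
    then obtain e where e: "e > 0" "\<And>a. a \<in> A \<Longrightarrow> e \<le> N (a - p)"
      using cl[of p] by (meson DiffD1 DiffD2 not_le)
    have "\<exists>f. linear f \<and> (\<forall>x. f x \<le> N x) \<and> (\<forall>a\<in>A. f a + e \<le> f p)"
      using e by (intro separation A False) auto
    then obtain f where f: "linear f" "\<And>x. f x \<le> N x" "\<And>a. a \<in> A \<Longrightarrow> f a + e \<le> f p"
      by blast
    define B where "B = {x \<in> C. f x \<in> {..f p - e}}"
    have "closedin W B"
      unfolding B_def using f by (intro closedin_W_functional dual_funI1) auto
    then have "openin W (C - B)"
      by (metis closedin_def topspace_W)
    moreover have "p \<in> C - B" using p e by (auto simp: B_def)
    moreover have "C - B \<subseteq> C - A"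
      using f(3) A(2) by (force simp: B_def)
    ultimately show "\<exists>T. openin W T \<and> p \<in> T \<and> T \<subseteq> C - A" by blast
  qed
  then show ?thesis using A by (simp add: closedin_def topspace_W)
qed simp

text \<open>The finite intersection property is applied to the weakly closed sets that eventually
  contain the sequence. Lying in all of them is the same as being a weak cluster point.\<close>

lemma cluster_point:
  assumes "\<And>n::nat. z n \<in> C"
  shows "\<exists>u\<in>C. \<forall>F. closedin W F \<longrightarrow> (\<forall>\<^sub>F n in sequentially. z n \<in> F) \<longrightarrow> u \<in> F"
proof -
  define U where "U = {F. closedin W F \<and> (\<forall>\<^sub>F n in sequentially. z n \<in> F)}"
  have fip: "\<Inter>G \<noteq> {}" if "finite G" "G \<subseteq> U" for G
  proof -
    have "\<forall>\<^sub>F n in sequentially. \<forall>F\<in>G. z n \<in> F"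
      using that by (intro eventually_ball_finite) (auto simp: U_def)
    then obtain n where "\<forall>F\<in>G. z n \<in> F"
      using eventually_happens trivial_limit_sequentially by blast
    then show ?thesis by blast
  qed
  have "\<forall>F\<in>U. closedin W F" by (simp add: U_def)
  then have "\<Inter>U \<noteq> {}"
    using fip compact_space_W[unfolded compact_space_fip, THEN spec, of U] by metis
  then obtain u where "u \<in> \<Inter>U" by blast
  moreover have "C \<in> U"
    using assms closedin_topspace[of W] by (simp add: U_def topspace_W)
  ultimately show ?thesis by (auto simp: U_def)
qed

text \<open>Otherwise \<open>|f|\<close> exceeds \<open>n\<close> at some \<open>z n\<close>. As
  \<open>|f| \<ge> m\<close> defines a weakly closed set, a cluster point would satisfy this for
  every \<open>m\<close>.\<close>

lemma functional_bounded:
  assumes f: "f \<in> dual_fun V N"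
  shows "\<exists>b. \<forall>x\<in>C. \<bar>f x\<bar> \<le> b"
proof (rule ccontr)
  assume "\<not> ?thesis"
  then have "\<forall>n::nat. \<exists>x. x \<in> C \<and> real n < \<bar>f x\<bar>" by (meson not_le)
  then obtain z where z: "\<And>n. z n \<in> C" "\<And>n. real n < \<bar>f (z n)\<bar>" by metis
  obtain u where u: "u \<in> C" "\<And>F. closedin W F \<Longrightarrow> \<forall>\<^sub>F n in sequentially. z n \<in> F \<Longrightarrow> u \<in> F"
    using cluster_point[of z] z(1) by blast
  have "u \<in> {x \<in> C. f x \<in> {y. real m \<le> \<bar>y\<bar>}}" for m
  proof (rule u(2))
    show "closedin W {x \<in> C. f x \<in> {y. real m \<le> \<bar>y\<bar>}}"
      by (intro closedin_W_functional f closed_Collect_le continuous_intros)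
    have "z n \<in> {x \<in> C. f x \<in> {y. real m \<le> \<bar>y\<bar>}}" if "n \<ge> m" for n
      using z(1)[of n] z(2)[of n] that by simp
    then show "\<forall>\<^sub>F n in sequentially. z n \<in> {x \<in> C. f x \<in> {y. real m \<le> \<bar>y\<bar>}}"
      using eventually_sequentially by blast
  qed
  then have "real m \<le> \<bar>f u\<bar>" for m by blast
  then show False using reals_Archimedean2[of "\<bar>f u\<bar>"] by (meson not_le)
qed

text \<open>Gliding hump: if \<open>N x\<^sub>k > 4\<^sup>k\<close>, the signs in \<open>f = \<Sum>\<plusminus> 3\<^sup>-\<^sup>k g\<^sub>k\<close>, where \<open>g\<^sub>k\<close> norms \<open>x\<^sub>k\<close>,
  can be chosen one after the other so that \<open>f x\<^sub>k\<close> is unbounded.\<close>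

lemma weakly_compact_bounded: "\<exists>b. \<forall>x\<in>C. N x \<le> b"
proof (rule ccontr)
  assume "\<not> ?thesis"
  then have "\<forall>k::nat. \<exists>x. x \<in> C \<and> 4 ^ k < N x" by (meson not_le)
  then obtain X where X: "\<And>k. X k \<in> C" "\<And>k::nat. 4 ^ k < N (X k)" by metis
  have "\<forall>k. \<exists>g. linear g \<and> (\<forall>x. g x \<le> N x) \<and> g (X k) = N (X k)"
    using norming_functional by blast
  then obtain g where g: "\<And>k. linear (g k)" "\<And>k x. g k x \<le> N x" "\<And>k. g k (X k) = N (X k)"
    by metis
  have g_abs: "\<bar>g k x\<bar> \<le> N x" for k x by (rule linear_le_abs[OF g(1,2)])
  \<comment> \<open>\<open>F k\<close> is the sum of the first \<open>k\<close> terms. The sign of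
    the next term is that of \<open>F k (X k)\<close>, with 0 counted as positive, so nothing
    cancels at \<open>X k\<close>.\<close>
  define F where "F = rec_nat (\<lambda>_. 0) (\<lambda>k Fk x. Fk x + (if Fk (X k) \<ge> 0 then 1 else - 1) * (1/3)^k * g k x)"
  define s :: "nat \<Rightarrow> real" where "s = (\<lambda>k. if F k (X k) \<ge> 0 then 1 else - 1)"
  define t where "t = (\<lambda>x k. s k * (1/3)^k * g k x)"
  define f where "f = (\<lambda>x. \<Sum>k. t x k)"
  have F_Suc: "F (Suc k) x = F k x + t x k" for k x
    by (simp add: F_def t_def s_def)
  have F_sum: "F k x = (\<Sum>j<k. t x j)" for k x
    by (induction k) (simp_all add: F_Suc, simp add: F_def)
  have s_abs: "\<bar>s k\<bar> = 1" for k by (simp add: s_def)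
  have t_abs: "\<bar>t x k\<bar> \<le> (1/3)^k * N x" for x k
    using g_abs[of k x] by (simp add: t_def abs_mult s_abs)
  have geo: "summable (\<lambda>k. (1/3::real)^k * N x)" for x
    by (intro summable_mult2 summable_geometric) simp
  have t_sum: "summable (t x)" for x
    by (rule summable_comparison_test'[OF geo[of x]]) (use t_abs in auto)
  have "linear f"
  proof (rule linearI)
    show "f (x + y) = f x + f y" for x y
      unfolding f_def suminf_add[OF t_sum t_sum]
      by (rule suminf_cong) (simp add: t_def linear_add[OF g(1)] algebra_simps)
    show "f (c *\<^sub>R x) = c *\<^sub>R f x" for c x
      unfolding f_def real_scaleR_def suminf_mult[OF t_sum, symmetric]
      by (rule suminf_cong) (simp add: t_def linear_scale[OF g(1)] algebra_simps)
  qed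
  moreover have "\<bar>f x\<bar> \<le> (3/2) * N x" for x
  proof -
    have "\<bar>f x\<bar> \<le> (\<Sum>k. (1/3)^k * N x)"
      unfolding f_def using norm_suminf_le[of "t x", OF _ geo[of x]] t_abs by simp
    also have "\<dots> = (3/2) * N x"
      using suminf_mult2[of "\<lambda>k. (1/3::real)^k" "N x"] suminf_geometric[of "1/3::real"] by simp
    finally show ?thesis .
  qed
  ultimately have "f \<in> dual_fun V N" by (rule dual_funI)
  then obtain b where b: "\<And>x. x \<in> C \<Longrightarrow> \<bar>f x\<bar> \<le> b" using functional_bounded by blast
  \<comment> \<open>At \<open>X k\<close> the first \<open>Suc k\<close> terms amount to at least
    \<open>(1/3)^k * N (X k)\<close>, and the geometric tail to at most half of that. Since
    \<open>N (X k) > 4^k\<close>, at least \<open>(4/3)^k / 2\<close> remains.\<close>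
  have low: "(4/3)^k / 2 \<le> \<bar>f (X k)\<bar>" for k
  proof -
    have "f (X k) - F (Suc k) (X k) = (\<Sum>j. t (X k) (j + Suc k))"
      unfolding f_def F_sum by (subst suminf_minus_initial_segment[OF t_sum]) simp
    moreover have "\<bar>\<Sum>j. t (X k) (j + Suc k)\<bar> \<le> (\<Sum>j. (1/3)^(j + Suc k) * N (X k))"
    proof -
      have "summable (\<lambda>j. (1/3::real)^(j + Suc k) * N (X k))"
        using summable_ignore_initial_segment[OF geo[of "X k"], of "Suc k"] .
      then have "norm (\<Sum>j. t (X k) (j + Suc k)) \<le> (\<Sum>j. (1/3)^(j + Suc k) * N (X k))"
        by (rule norm_suminf_le[rotated]) (simp only: real_norm_def t_abs)
      then show ?thesis by (simp only: real_norm_def)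
    qed
    moreover have "(\<Sum>j. (1/3::real)^(j + Suc k) * N (X k)) = (1/3)^k * N (X k) / 2"
    proof -
      have "(\<Sum>j. (1/3::real)^(j + Suc k) * N (X k)) = (\<Sum>j. (1/3)^j * ((1/3)^Suc k * N (X k)))"
        by (simp add: power_add mult_ac)
      also have "\<dots> = (\<Sum>j. (1/3)^j) * ((1/3)^Suc k * N (X k))"
        by (rule suminf_mult2[symmetric]) (simp add: summable_geometric)
      also have "\<dots> = (1/3)^k * N (X k) / 2"
        using suminf_geometric[of "1/3::real"] by simp
      finally show ?thesis .
    qed
    moreover have "(1/3)^k * N (X k) \<le> \<bar>F (Suc k) (X k)\<bar>"
    proof -
      have "b \<le> \<bar>a + (if 0 \<le> a then 1 else - 1) * b\<bar>" if "0 \<le> b" for a b :: real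
        using that by auto
      then have "(1/3)^k * N (X k) \<le> \<bar>F k (X k) + s k * ((1/3)^k * N (X k))\<bar>"
        unfolding s_def by simp
      then show ?thesis by (simp add: F_Suc t_def g(3) mult.assoc)
    qed
    ultimately have "(1/3)^k * N (X k) / 2 \<le> \<bar>f (X k)\<bar>" by linarith
    moreover have "(4/3)^k \<le> (1/3)^k * N (X k)"
      using X(2)[of k] by (simp add: power_divide field_simps)
    ultimately show ?thesis by linarith
  qed
  obtain k :: nat where "2 * b < (4/3)^k" using real_arch_pow[of "4/3" "2 * b"] by auto
  then show False using low[of k] b[OF X(1), of k] by linarith
qed

text \<open>Rational combinations are coded as lists of coefficients and indices. Such lists form a
  countable type, so one sequence of norming functionals can handle all combinations.\<close>

lemma span_rational_approx:
  assumes "w \<in> span (range z)"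
  shows "\<forall>e>0. \<exists>l. N (w - foldr (\<lambda>(r, n) y. real_of_rat r *\<^sub>R z n + y) l 0) < e"
  using assms
proof (induction rule: span_induct_alt)
  case base
  have "N (0 - foldr (\<lambda>(r, n) y. real_of_rat r *\<^sub>R z n + y) [] 0) < e" if "e > 0" for e
    using that by simp
  then show ?case by blast
next
  case (step c x y)
  show ?case
  proof (intro allI impI)
    fix e :: real assume e: "e > 0"
    obtain n where n: "x = z n" using step by auto
    have "e / 2 > 0" using e by simp
    then obtain l where l: "N (y - foldr (\<lambda>(r, n) y. real_of_rat r *\<^sub>R z n + y) l 0) < e / 2"
      using step(2) by blast
    \<comment> \<open>An error below \<open>d\<close> in the coefficient moves the vector by at most
      \<open>e / 2\<close>; the \<open>+ 1\<close> protects against \<open>N x = 0\<close>.\<close>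
    define d where "d = e / (2 * (N x + 1))"
    have Nx: "N x + 1 > 0" using N_nonneg[of x] by linarith
    then have d: "d > 0" using e by (simp add: d_def)
    obtain r where r: "c < real_of_rat r" "real_of_rat r < c + d"
      using of_rat_dense[of c "c + d"] d by auto
    have "\<bar>c - real_of_rat r\<bar> * N x \<le> d * (N x + 1)"
      using r Nx d by (intro mult_mono) auto
    also have "\<dots> = e / 2" using Nx by (simp add: d_def del: distrib_left_numeral)
    finally have "N ((c - real_of_rat r) *\<^sub>R x) \<le> e / 2" by (simp add: N_scaleR)
    then have "N ((c - real_of_rat r) *\<^sub>R x + (y - foldr (\<lambda>(r, n) y. real_of_rat r *\<^sub>R z n + y) l 0)) < e"
      using N_triangle[of "(c - real_of_rat r) *\<^sub>R x" "y - foldr (\<lambda>(r, n) y. real_of_rat r *\<^sub>R z n + y) l 0"] l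
      by linarith
    then have "N (c *\<^sub>R x + y - foldr (\<lambda>(r, n) y. real_of_rat r *\<^sub>R z n + y) ((r, n) # l) 0) < e"
      by (simp add: n algebra_simps)
    then show "\<exists>l. N (c *\<^sub>R x + y - foldr (\<lambda>(r, n) y. real_of_rat r *\<^sub>R z n + y) l 0) < e" by blast
  qed
qed

text \<open>The Eberlein--Smulian theorem. Functionals norming the countably many rational
  combinations of the sequence separate the points of its closed span, so a subsequence along
  which all of them converge has only one cluster point.\<close>

theorem weakly_convergent_subsequence:
  fixes z :: "nat \<Rightarrow> 'v"
  assumes z: "\<And>n. z n \<in> C"
  shows "\<exists>\<sigma> u. strict_mono \<sigma> \<and> u \<in> C \<and> wconv V (z \<circ> \<sigma>) u
    \<and> (\<forall>F. closedin W F \<longrightarrow> range z \<subseteq> F \<longrightarrow> u \<in> F)"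
proof -
  define comb where "comb = (\<lambda>l :: (rat \<times> nat) list. foldr (\<lambda>(r, n) y. real_of_rat r *\<^sub>R z n + y) l 0)"
  have "\<forall>j::nat. \<exists>f. linear f \<and> (\<forall>x. f x \<le> N x) \<and> f (comb (from_nat j)) = N (comb (from_nat j))"
    using norming_functional by blast
  then obtain g where g: "\<And>j. linear (g j)" "\<And>j x. g j x \<le> N x"
    "\<And>j. g j (comb (from_nat j)) = N (comb (from_nat j))" by metis
  have g_dual: "g j \<in> dual_fun V N" for j by (rule dual_funI1[OF g(1,2)])
  have "bounded (range (\<lambda>n. g j (z n)))" for j
    using functional_bounded[OF g_dual] z by (fastforce simp: bounded_iff)
  then obtain \<sigma> where \<sigma>: "strict_mono \<sigma>" "\<And>j. convergent (\<lambda>n. g j (z (\<sigma> n)))"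
    using diagonal_convergent[of "\<lambda>j n. g j (z n)"] by blast
  define cluster where "cluster = (\<lambda>y u. u \<in> C \<and>
    (\<forall>F. closedin W F \<longrightarrow> (\<forall>\<^sub>F n in sequentially. y n \<in> F) \<longrightarrow> u \<in> F))"
  \<comment> \<open>The part of \<open>C\<close> in the norm closure of the span is convex and norm
    closed, hence weakly closed, so it contains every cluster point.\<close>
  define A where "A = {x \<in> C. \<forall>e>0. \<exists>w\<in>span (range z). N (w - x) < e}"
  have cluster_A: "u \<in> A" if "cluster (z \<circ> \<rho>) u" for \<rho> u
  proof -
    have "closedin W A"
    proof (rule closedin_W_convex)
      show "A \<subseteq> C" by (auto simp: A_def)
      show "convex A"
      proof (rule convexI)
        fix x y u v assume xy: "x \<in> A" "y \<in> A" and uv: "0 \<le> u" "0 \<le> v" "u + v = (1::real)"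
        have "\<exists>w\<in>span (range z). N (w - (u *\<^sub>R x + v *\<^sub>R y)) < e" if e: "e > 0" for e
        proof -
          have e2: "e / 2 > 0" using e by simp
          obtain a where a: "a \<in> span (range z)" "N (a - x) < e / 2"
            using xy(1) e2 unfolding A_def by blast
          obtain b where b: "b \<in> span (range z)" "N (b - y) < e / 2"
            using xy(2) e2 unfolding A_def by blast
          have "N (u *\<^sub>R (a - x) + v *\<^sub>R (b - y)) \<le> u * (e / 2) + v * (e / 2)"
            using a b uv by (intro N_convex) auto
          also have "\<dots> = e / 2" using uv(3) by (metis distrib_right mult_1)
          also have "\<dots> < e" using e by simp
          finally have "N ((u *\<^sub>R a + v *\<^sub>R b) - (u *\<^sub>R x + v *\<^sub>R y)) < e"
            by (simp add: algebra_simps)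
          moreover have "u *\<^sub>R a + v *\<^sub>R b \<in> span (range z)"
            using a b by (intro span_add span_scale)
          ultimately show ?thesis by blast
        qed
        moreover have "u *\<^sub>R x + v *\<^sub>R y \<in> C"
          using xy uv convex_C by (intro convexD) (auto simp: A_def)
        ultimately show "u *\<^sub>R x + v *\<^sub>R y \<in> A" by (simp add: A_def)
      qed
      show "p \<in> A" if p: "p \<in> C" "\<And>e. e > 0 \<Longrightarrow> \<exists>a\<in>A. N (a - p) < e" for p
      proof -
        have "\<exists>w\<in>span (range z). N (w - p) < e" if e: "e > 0" for e
        proof -
          obtain a where a: "a \<in> A" "N (a - p) < e / 2" using p(2)[of "e / 2"] e by auto
          moreover have "e / 2 > 0" using e by simp
          ultimately obtain w where "w \<in> span (range z)" "N (w - a) < e / 2"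
            unfolding A_def by blast
          then show ?thesis using a N_triangle_sub[of w p a] by force
        qed
        then show ?thesis using p(1) by (simp add: A_def)
      qed
    qed
    moreover have "z n \<in> A" for n
    proof -
      have "\<exists>w\<in>span (range z). N (w - z n) < e" if "e > 0" for e
        using that by (intro bexI[of _ "z n"]) (auto intro: span_base)
      then show ?thesis using z by (simp add: A_def)
    qed
    ultimately show ?thesis using that by (simp add: cluster_def)
  qed
  have cluster_g: "(\<lambda>n. g j (z (\<sigma> n))) \<longlonglongrightarrow> g j u"
    if cl: "cluster (z \<circ> (\<sigma> \<circ> \<tau>)) u" and \<tau>: "strict_mono \<tau>" for j u \<tau>
  proof -
    obtain l where l: "(\<lambda>n. g j (z (\<sigma> n))) \<longlonglongrightarrow> l" using \<sigma>(2) by (auto simp: convergent_def)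
    have l\<tau>: "(\<lambda>n. g j (z (\<sigma> (\<tau> n)))) \<longlonglongrightarrow> l"
      using LIMSEQ_subseq_LIMSEQ[OF l \<tau>] by (simp add: comp_def)
    have "dist l (g j u) \<le> e" if e: "e > 0" for e
    proof -
      have "u \<in> {x \<in> C. g j x \<in> cball l e}"
      proof -
        have "\<forall>\<^sub>F n in sequentially. g j (z (\<sigma> (\<tau> n))) \<in> cball l e"
          using tendstoD[OF l\<tau> e] by eventually_elim (simp add: dist_commute)
        then have "\<forall>\<^sub>F n in sequentially. (z \<circ> (\<sigma> \<circ> \<tau>)) n \<in> {x \<in> C. g j x \<in> cball l e}"
          using z by simp
        then show ?thesis
          using cl closedin_W_functional[OF g_dual closed_cball] unfolding cluster_def by blast
      qed
      then show ?thesis by simp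
    qed
    then have "dist l (g j u) \<le> 0" by (rule dense_ge)
    then have "l = g j u" by simp
    then show ?thesis using l by simp
  qed
  \<comment> \<open>All \<open>g j\<close> vanish on \<open>u - v\<close>, which is within
    \<open>e / 2\<close> of a rational combination. The functional norming this combination takes
    the same value at its difference from \<open>u - v\<close>, so the combination, and then
    \<open>u - v\<close>, is small.\<close>
  have unique: "u = v"
    if u: "cluster (z \<circ> (\<sigma> \<circ> \<tau>)) u" "strict_mono \<tau>"
      and v: "cluster (z \<circ> (\<sigma> \<circ> \<rho>)) v" "strict_mono \<rho>" for u v \<tau> \<rho>
  proof -
    have guv: "g j (u - v) = 0" for j
      using LIMSEQ_unique[OF cluster_g[OF u] cluster_g[OF v]] linear_diff[OF g(1)] by simp
    have "N (u - v) \<le> 0 + e" if e: "e > 0" for e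
    proof -
      have e8: "e / 8 > 0" using e by simp
      obtain a where a: "a \<in> span (range z)" "N (a - u) < e / 8"
        using cluster_A[OF u(1)] e8 unfolding A_def by blast
      obtain b where b: "b \<in> span (range z)" "N (b - v) < e / 8"
        using cluster_A[OF v(1)] e8 unfolding A_def by blast
      have "a - b \<in> span (range z)" using a b by (simp add: span_diff)
      moreover have "e / 4 > 0" using e by simp
      ultimately obtain l where l: "N (a - b - comb l) < e / 4"
        using span_rational_approx[of "a - b" z] unfolding comb_def by blast
      have "N (a - b - (u - v)) \<le> e / 4"
        using N_diff[of "a - u" "b - v"] a b by (simp add: algebra_simps)
      then have d: "N (comb l - (u - v)) \<le> e / 2"
        using N_triangle_sub[of "comb l" "u - v" "a - b"] l N_minus_commute[of "a - b" "comb l"] by linarith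
      have "N (comb l) = g (to_nat l) (comb l)" using g(3)[of "to_nat l"] by simp
      also have "\<dots> = g (to_nat l) (comb l - (u - v))" using guv[of "to_nat l"] linear_diff[OF g(1), of "to_nat l" "comb l" "u - v"] by simp
      also have "\<dots> \<le> e / 2" using g(2) d by (rule order_trans)
      finally show ?thesis
        using N_reverse[of "u - v" "comb l"] d N_minus_commute[of "u - v" "comb l"] by linarith
    qed
    then have "N (u - v) \<le> 0" by (rule field_le_epsilon)
    then show ?thesis using N_eq_0[of "u - v"] N_nonneg[of "u - v"] by simp
  qed
  obtain u where u: "cluster (z \<circ> (\<sigma> \<circ> id)) u"
    using cluster_point[of "z \<circ> \<sigma>"] z by (auto simp: cluster_def comp_def)
  have "(\<lambda>n. f ((z \<circ> \<sigma>) n)) \<longlonglongrightarrow> f u" if f: "f \<in> dual_fun V N" for f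
  proof (rule tendstoI, rule ccontr)
    fix e :: real assume e: "e > 0" and "\<not> (\<forall>\<^sub>F n in sequentially. dist (f ((z \<circ> \<sigma>) n)) (f u) < e)"
    \<comment> \<open>If convergence failed, a subsequence would keep \<open>f\<close> at distance
      \<open>e\<close> from \<open>f u\<close>. Its cluster point inherits this, but equals
      \<open>u\<close> by uniqueness.\<close>
    then have "infinite {n. e \<le> dist (f ((z \<circ> \<sigma>) n)) (f u)}"
      unfolding not_eventually by (simp add: frequently_cofinite not_less flip: cofinite_eq_sequentially)
    then obtain \<tau> :: "nat \<Rightarrow> nat" where \<tau>: "strict_mono \<tau>"
      "\<And>n. \<tau> n \<in> {n. e \<le> dist (f ((z \<circ> \<sigma>) n)) (f u)}"
      using infinite_enumerate by blast
    obtain v where v: "cluster (z \<circ> (\<sigma> \<circ> \<tau>)) v"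
      using cluster_point[of "z \<circ> (\<sigma> \<circ> \<tau>)"] z by (auto simp: cluster_def comp_def)
    have "closed {y. e \<le> dist y (f u)}" by (intro closed_Collect_le continuous_intros)
    from closedin_W_functional[OF f this] have "v \<in> {x \<in> C. f x \<in> {y. e \<le> dist y (f u)}}"
      using v \<tau>(2) z unfolding cluster_def by (auto simp: comp_def)
    moreover have "v = u" by (rule unique[OF v \<tau>(1) u]) (simp add: strict_mono_def)
    ultimately show False using e by simp
  qed
  then have "wconv V (z \<circ> \<sigma>) u" by (simp add: wconv_def)
  moreover have "u \<in> F" if "closedin W F" "range z \<subseteq> F" for F
  proof -
    have "\<forall>\<^sub>F n in sequentially. (z \<circ> (\<sigma> \<circ> id)) n \<in> F" using that(2) by (intro always_eventually) auto
    then show ?thesis using u that(1) unfolding cluster_def by blast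
  qed
  moreover have "u \<in> C" using u by (simp add: cluster_def)
  ultimately show ?thesis using \<sigma>(1) by blast
qed

end

section \<open>Weakly closed convex sets defined by balls, and minimal invariant sets\<close>

context weakly_compact_set
begin

lemma convex_balls:
  assumes A: "convex A"
  shows "convex {z \<in> A. \<forall>x\<in>S. N (z - x) \<le> s}"
proof (rule convexI)
  fix x y u v
  assume xy: "x \<in> {z \<in> A. \<forall>x\<in>S. N (z - x) \<le> s}" "y \<in> {z \<in> A. \<forall>x\<in>S. N (z - x) \<le> s}"
    and uv: "0 \<le> u" "0 \<le> v" "u + v = (1::real)"
  have "N (u *\<^sub>R x + v *\<^sub>R y - w) \<le> s" if "w \<in> S" for w
  proof -
    have "(u + v) *\<^sub>R w = w" using uv by simp
    then have "u *\<^sub>R x + v *\<^sub>R y - w = u *\<^sub>R (x - w) + v *\<^sub>R (y - w)"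
      by (simp add: algebra_simps)
    also have "N \<dots> \<le> u * s + v * s" using xy uv that by (intro N_convex) auto
    also have "\<dots> = s" using uv(3) by (metis distrib_right mult_1)
    finally show ?thesis .
  qed
  moreover have "u *\<^sub>R x + v *\<^sub>R y \<in> A" using xy uv by (intro convexD[OF A]) auto
  ultimately show "u *\<^sub>R x + v *\<^sub>R y \<in> {z \<in> A. \<forall>x\<in>S. N (z - x) \<le> s}" by simp
qed

text \<open>This is the sublevel set at \<open>s\<close> of the limsup of
  \<open>N (X n - x)\<close>, spelled out with \<open>e\<close>. A general convex \<open>A\<close>
  covers both \<open>C\<close> and a minimal invariant subset.\<close>

lemma convex_eventually_balls:
  fixes X :: "nat \<Rightarrow> 'v"
  assumes A: "convex A"
  shows "convex {x \<in> A. \<forall>e>0. \<forall>\<^sub>F n in sequentially. N (X n - x) \<le> s + e}" (is "convex ?L")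
proof (rule convexI)
  fix x y u v
  assume xy: "x \<in> ?L" "y \<in> ?L" and uv: "0 \<le> u" "0 \<le> v" "u + v = (1::real)"
  have "\<forall>\<^sub>F n in sequentially. N (X n - (u *\<^sub>R x + v *\<^sub>R y)) \<le> s + e" if e: "e > 0" for e
  proof -
    have "\<forall>\<^sub>F n in sequentially. N (X n - x) \<le> s + e" "\<forall>\<^sub>F n in sequentially. N (X n - y) \<le> s + e"
      using xy e by auto
    then show ?thesis
    proof eventually_elim
      case (elim n)
      have "(u + v) *\<^sub>R X n = X n" using uv by simp
      then have "X n - (u *\<^sub>R x + v *\<^sub>R y) = u *\<^sub>R (X n - x) + v *\<^sub>R (X n - y)"
        by (simp add: algebra_simps)
      also have "N \<dots> \<le> u * (s + e) + v * (s + e)" using elim uv by (intro N_convex) auto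
      also have "\<dots> = s + e" using uv(3) by (metis distrib_right mult_1)
      finally show ?case .
    qed
  qed
  moreover have "u *\<^sub>R x + v *\<^sub>R y \<in> A" using xy uv by (intro convexD[OF A]) auto
  ultimately show "u *\<^sub>R x + v *\<^sub>R y \<in> ?L" by simp
qed

lemma closedin_W_balls: "closedin W {z \<in> C. \<forall>x\<in>S. N (z - x) \<le> s}"
proof (rule closedin_W_convex)
  show "convex {z \<in> C. \<forall>x\<in>S. N (z - x) \<le> s}" by (rule convex_balls[OF convex_C])
next
  fix p assume p: "p \<in> C" "\<And>e. e > 0 \<Longrightarrow> \<exists>a\<in>{z \<in> C. \<forall>x\<in>S. N (z - x) \<le> s}. N (a - p) < e"
  have "N (p - x) \<le> s" if x: "x \<in> S" for x
  proof (rule field_le_epsilon)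
    fix e :: real assume "e > 0"
    then obtain a where "N (a - x) \<le> s" "N (a - p) < e" using p(2) x by blast
    then show "N (p - x) \<le> s + e"
      using N_triangle_sub[of p x a] N_minus_commute[of a p] by linarith
  qed
  then show "p \<in> {z \<in> C. \<forall>x\<in>S. N (z - x) \<le> s}" using p(1) by simp
qed auto

lemma closedin_W_eventually_balls:
  "closedin W {x \<in> C. \<forall>e>0. \<forall>\<^sub>F n in sequentially. N (X n - x) \<le> s + e}" (is "closedin W ?L")
proof (rule closedin_W_convex)
  show "convex ?L" by (rule convex_eventually_balls[OF convex_C])
next
  fix p assume p: "p \<in> C" "\<And>e. e > 0 \<Longrightarrow> \<exists>a\<in>?L. N (a - p) < e"
  have "\<forall>\<^sub>F n in sequentially. N (X n - p) \<le> s + e" if "e > 0" for e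
  proof -
    have e2: "e / 2 > 0" using that by simp
    then obtain a where a: "a \<in> ?L" "N (a - p) < e / 2" using p(2) by blast
    then have "\<forall>\<^sub>F n in sequentially. N (X n - a) \<le> s + e / 2" using e2 by blast
    then show ?thesis
    proof eventually_elim
      case (elim n)
      then show ?case using N_triangle_sub[of "X n" p a] a(2) by linarith
    qed
  qed
  then show "p \<in> ?L" using p(1) by simp
qed auto

text \<open>Zorn's lemma for reverse inclusion: a finite part of a chain has a least member, so weak
  compactness makes the intersection of the chain nonempty.\<close>

lemma minimal_invariant_exists:
  assumes "C \<noteq> {}" "T ` C \<subseteq> C"
  shows "\<exists>K. K \<noteq> {} \<and> convex K \<and> closedin W K \<and> T ` K \<subseteq> K \<and>
    (\<forall>L. L \<subseteq> K \<longrightarrow> L \<noteq> {} \<longrightarrow> convex L \<longrightarrow> closedin W L \<longrightarrow> T ` L \<subseteq> L \<longrightarrow> L = K)"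
proof -
  define A where "A = {K. K \<noteq> {} \<and> convex K \<and> closedin W K \<and> T ` K \<subseteq> K}"
  have "\<exists>m\<in>A. \<forall>a\<in>A. a \<subseteq> m \<longrightarrow> a = m"
  proof (rule predicate_Zorn)
    show "partial_order_on A (relation_of (\<lambda>K L. L \<subseteq> K) A)"
      by (rule partial_order_on_relation_ofI) auto
  next
    fix Ch assume Ch: "Ch \<in> Chains (relation_of (\<lambda>K L. L \<subseteq> K) A)"
    have ChA: "Ch \<subseteq> A" using Ch by (auto simp: Chains_def relation_of_def)
    have tot: "K \<subseteq> L \<or> L \<subseteq> K" if "K \<in> Ch" "L \<in> Ch" for K L
      using Ch that by (auto simp: Chains_def relation_of_def)
    show "\<exists>u\<in>A. \<forall>a\<in>Ch. u \<subseteq> a"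
    proof (cases "Ch = {}")
      case True
      have "C \<in> A" using assms convex_C closedin_topspace[of W] by (simp add: A_def topspace_W)
      then show ?thesis using True by blast
    next
      case False
      have least: "\<exists>m\<in>G. \<forall>K\<in>G. m \<subseteq> K" if "finite G" "G \<noteq> {}" "G \<subseteq> Ch" for G
        using that
      proof (induction rule: finite_ne_induct)
        case (insert K G)
        then obtain m where m: "m \<in> G" "\<forall>K\<in>G. m \<subseteq> K" by auto
        then have "m \<subseteq> K \<or> K \<subseteq> m" using insert.prems tot by auto
        then show ?case using m by (metis insert_iff subset_refl subset_trans)
      qed simp
      have fip: "\<Inter>G \<noteq> {}" if G: "finite G" "G \<subseteq> Ch" for G
      proof (cases "G = {}")
        case False
        then obtain m where m: "m \<in> G" "\<forall>K\<in>G. m \<subseteq> K" using least[OF G(1) _ G(2)] by blast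
        then have "m \<noteq> {}" using ChA G by (auto simp: A_def)
        then show ?thesis using m(2) by blast
      qed simp
      have cl: "\<forall>F\<in>Ch. closedin W F" using ChA by (auto simp: A_def)
      then have ne: "\<Inter>Ch \<noteq> {}"
        using fip compact_space_W[unfolded compact_space_fip, THEN spec, of Ch] by metis
      have "convex (\<Inter>Ch)" using ChA by (intro convex_Inter) (auto simp: A_def)
      moreover have "closedin W (\<Inter>Ch)" using cl False by blast
      moreover have "T ` \<Inter>Ch \<subseteq> \<Inter>Ch" using ChA unfolding A_def by blast
      ultimately have "\<Inter>Ch \<in> A" using ne by (simp add: A_def)
      then show ?thesis by (meson Inter_lower)
    qed
  qed
  then obtain K where "K \<in> A" "\<forall>L\<in>A. L \<subseteq> K \<longrightarrow> L = K" by blast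
  then show ?thesis unfolding A_def by blast
qed

end

section \<open>Minimal invariant sets of nonexpansive maps\<close>

locale minimal_invariant_set = weakly_compact_set N V C
  for N :: "'v::real_vector \<Rightarrow> real" and V C :: "'v set" +
  fixes T :: "'v \<Rightarrow> 'v" and K :: "'v set"
  assumes K_nonempty: "K \<noteq> {}" and K_convex: "convex K" and K_closed: "closedin W K"
    and K_invariant: "T ` K \<subseteq> K"
    and nonexpansive: "\<And>x y. x \<in> K \<Longrightarrow> y \<in> K \<Longrightarrow> N (T x - T y) \<le> N (x - y)"
    and K_minimal: "\<And>L. L \<subseteq> K \<Longrightarrow> L \<noteq> {} \<Longrightarrow> convex L \<Longrightarrow> closedin W L \<Longrightarrow> T ` L \<subseteq> L \<Longrightarrow> L = K"
begin

definition diam :: real where "diam = (SUP (x, y)\<in>K \<times> K. N (x - y))"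

lemma K_subset: "K \<subseteq> C"
  using closedin_subset[OF K_closed] by (simp add: topspace_W)

lemma T_in: "x \<in> K \<Longrightarrow> T x \<in> K"
  using K_invariant by blast

lemma le_diam:
  assumes "x \<in> K" "y \<in> K"
  shows "N (x - y) \<le> diam"
proof -
  \<comment> \<open>Boundedness of weakly compact sets makes the supremum defining
    \<open>diam\<close> a genuine upper bound.\<close>
  obtain b where b: "\<And>x. x \<in> C \<Longrightarrow> N x \<le> b" using weakly_compact_bounded by blast
  have "N (x - y) \<le> b + b" if "x \<in> K" "y \<in> K" for x y
    using b[of x] b[of y] N_diff[of x y] that K_subset by fastforce
  then have "bdd_above ((\<lambda>(x, y). N (x - y)) ` (K \<times> K))"
    by (intro bdd_aboveI2[where M = "b + b"]) auto
  then show ?thesis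
    unfolding diam_def using assms by (intro cSUP_upper2[where x = "(x, y)"]) auto
qed

lemma diam_le:
  assumes "\<And>x y. x \<in> K \<Longrightarrow> y \<in> K \<Longrightarrow> N (x - y) \<le> s"
  shows "diam \<le> s"
  unfolding diam_def using assms K_nonempty by (intro cSUP_least) auto

lemma diam_nonneg: "0 \<le> diam"
  using K_nonempty le_diam N_nonneg order_trans by blast

text \<open>Suppose almost fixed points \<open>X n\<close> stay within \<open>s = diam - e\<close>
  of \<open>y\<close>. The points of \<open>K\<close> at asymptotic distance at most
  \<open>s\<close> from \<open>X\<close> form an invariant set, hence all of \<open>K\<close>. A
  weak cluster point of \<open>X\<close> is then within \<open>s\<close> of all of \<open>K\<close>;
  such points again form an invariant set, so \<open>diam \<le> s\<close>.\<close>

lemma goebel_karlovitz: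
  assumes y: "y \<in> K" and e: "e > 0"
  shows "\<exists>\<delta>>0. \<forall>x\<in>K. N (T x - x) < \<delta> \<longrightarrow> diam - e < N (x - y)"
proof (rule ccontr)
  assume contra: "\<not> ?thesis"
  have "\<forall>n::nat. \<exists>x. x \<in> K \<and> N (T x - x) < inverse (real (Suc n)) \<and> N (x - y) \<le> diam - e"
    using contra by (metis inverse_positive_iff_positive not_le of_nat_0_less_iff zero_less_Suc)
  then obtain X where X: "\<And>n::nat. X n \<in> K" "\<And>n. N (T (X n) - X n) < inverse (real (Suc n))"
    "\<And>n. N (X n - y) \<le> diam - e" by metis
  define s where "s = diam - e"
  define L0 where "L0 = {x \<in> C. \<forall>e>0. \<forall>\<^sub>F n in sequentially. N (X n - x) \<le> s + e}"
  define L where "L = K \<inter> L0"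
  \<comment> \<open>Minimality for intersections of balls, used below with \<open>S\<close> equal to
    \<open>K\<close> and to the singleton of \<open>T z\<close>.\<close>
  have K_ball: "L' = K" if L': "L' = K \<inter> {z \<in> C. \<forall>x\<in>S. N (z - x) \<le> r}" "L' \<noteq> {}" "T ` L' \<subseteq> L'" for L' S r
  proof (rule K_minimal)
    show "closedin W L'" unfolding L'(1) by (intro closedin_Int K_closed closedin_W_balls)
    have "L' = {z \<in> K. \<forall>x\<in>S. N (z - x) \<le> r}" using L'(1) K_subset by blast
    then show "convex L'" by (simp add: convex_balls[OF K_convex])
  qed (use L' in auto)
  have "L = K"
  proof (rule K_minimal)
    show "closedin W L"
      unfolding L_def L0_def by (intro closedin_Int K_closed closedin_W_eventually_balls)
    have "L = {x \<in> K. \<forall>e>0. \<forall>\<^sub>F n in sequentially. N (X n - x) \<le> s + e}"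
      using K_subset unfolding L_def L0_def by blast
    then show "convex L" by (simp add: convex_eventually_balls[OF K_convex])
    have "y \<in> L"
      using y K_subset X(3) by (auto simp: L_def L0_def s_def intro!: always_eventually add_increasing2)
    then show "L \<noteq> {}" by blast
    show "T ` L \<subseteq> L"
    proof
      fix z assume "z \<in> T ` L"
      then obtain x where x: "x \<in> K" "x \<in> L0" "z = T x" by (auto simp: L_def)
      have "\<forall>\<^sub>F n in sequentially. N (X n - z) \<le> s + e" if e: "e > 0" for e
      proof -
        have e2: "e / 2 > 0" using e by simp
        have "\<forall>\<^sub>F n in sequentially. N (X n - x) \<le> s + e / 2"
          using x(2) e2 unfolding L0_def by blast
        moreover have "\<forall>\<^sub>F n in sequentially. inverse (real (Suc n)) < e / 2"
          by (rule order_tendstoD(2)[OF LIMSEQ_inverse_real_of_nat e2])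
        ultimately show ?thesis
        proof eventually_elim
          case (elim n)
          have "N (X n - z) \<le> N (X n - T (X n)) + N (T (X n) - T x)"
            unfolding x(3) by (rule N_triangle_sub)
          also have "\<dots> \<le> inverse (real (Suc n)) + N (X n - x)"
            using X(2)[of n] nonexpansive[OF X(1) x(1), of n] N_minus_commute[of "X n" "T (X n)"]
            by simp
          finally show ?case using elim by linarith
        qed
      qed
      then show "z \<in> L" using x T_in K_subset by (auto simp: L_def L0_def)
    qed
  qed (simp add: L_def)
  obtain u where u: "\<And>F. closedin W F \<Longrightarrow> \<forall>\<^sub>F n in sequentially. X n \<in> F \<Longrightarrow> u \<in> F"
    using cluster_point[of X] X(1) K_subset by blast
  have "u \<in> K" using u[OF K_closed] X(1) by simp
  have "N (u - x) \<le> s" if x: "x \<in> K" for x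
  proof (rule field_le_epsilon)
    fix e :: real assume "e > 0"
    then have "\<forall>\<^sub>F n in sequentially. N (X n - x) \<le> s + e"
      using x \<open>L = K\<close> unfolding L_def L0_def by blast
    then have "\<forall>\<^sub>F n in sequentially. X n \<in> {z \<in> C. \<forall>w\<in>{x}. N (z - w) \<le> s + e}"
      by eventually_elim (use X(1) K_subset in auto)
    from u[OF closedin_W_balls this] show "N (u - x) \<le> s + e" by simp
  qed
  then have u_in: "u \<in> K \<inter> {z \<in> C. \<forall>x\<in>K. N (z - x) \<le> s}" using \<open>u \<in> K\<close> K_subset by auto
  have "K \<inter> {z \<in> C. \<forall>x\<in>K. N (z - x) \<le> s} = K"
  proof (rule K_ball[OF refl])
    show "K \<inter> {z \<in> C. \<forall>x\<in>K. N (z - x) \<le> s} \<noteq> {}" using u_in by blast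
    have "N (T z - x) \<le> s" if z: "z \<in> K" "\<forall>x\<in>K. N (z - x) \<le> s" and x: "x \<in> K" for z x
    proof -
      \<comment> \<open>The ball of radius \<open>s\<close> around \<open>T z\<close> contains the
        image of \<open>K\<close>, so its trace on \<open>K\<close> is invariant and equals
        \<open>K\<close>.\<close>
      have *: "N (T w - T z) \<le> s" if "w \<in> K" for w
        using nonexpansive[of w z] z that N_minus_commute[of w z] by fastforce
      have "K \<inter> {w \<in> C. \<forall>v\<in>{T z}. N (w - v) \<le> s} = K"
      proof (rule K_ball[OF refl])
        show "K \<inter> {w \<in> C. \<forall>v\<in>{T z}. N (w - v) \<le> s} \<noteq> {}"
          using * z T_in K_subset by blast
        show "T ` (K \<inter> {w \<in> C. \<forall>v\<in>{T z}. N (w - v) \<le> s}) \<subseteq> K \<inter> {w \<in> C. \<forall>v\<in>{T z}. N (w - v) \<le> s}"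
          using * T_in K_subset by blast
      qed
      then have "N (x - T z) \<le> s" using x by blast
      then show ?thesis by (simp add: N_minus_commute)
    qed
    then show "T ` (K \<inter> {z \<in> C. \<forall>x\<in>K. N (z - x) \<le> s}) \<subseteq> K \<inter> {z \<in> C. \<forall>x\<in>K. N (z - x) \<le> s}"
      using T_in K_subset by blast
  qed
  then have "diam \<le> s" by (intro diam_le) blast
  then show False using e by (simp add: s_def)
qed

text \<open>The map sending \<open>x\<close> to \<open>s z0 n + (1 - s) T x\<close> is iterated
  \<open>j\<close> times. It contracts by \<open>1 - s\<close> and differs from \<open>T\<close> by
  at most \<open>s * diam\<close>. The number \<open>j\<close> is the same for all \<open>n\<close>,
  so the error \<open>real j * N (T x - x)\<close> vanishes along almost fixed points
  \<open>x\<close>.\<close>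

lemma averaged_iterates:
  assumes z0: "\<And>n::nat. z0 n \<in> K" and \<delta>: "\<delta> > 0"
  shows "\<exists>z j. (\<forall>n. z n \<in> K) \<and> (\<forall>n. N (T (z n) - z n) < \<delta>)
    \<and> (\<forall>t. (\<forall>n m. N (z0 n - z0 m) \<le> t) \<longrightarrow> (\<forall>n m. N (z n - z m) \<le> t))
    \<and> (\<forall>n. \<forall>x\<in>K. N (z n - x) \<le> N (z0 n - x) + real j * N (T x - x))"
proof -
  \<comment> \<open>The second bound gives \<open>s * diam < \<delta> / 2\<close>, the first keeps
    \<open>1 - s\<close> positive; \<open>diam + 1\<close> avoids a zero denominator.\<close>
  define s where "s = min (1/2) (\<delta> / (2 * (diam + 1)))"
  have d1: "diam + 1 > 0" using diam_nonneg by linarith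
  have s: "0 < s" "s < 1" using \<delta> d1 by (auto simp: s_def)
  define Z where "Z = rec_nat z0 (\<lambda>_ z n. s *\<^sub>R z0 n + (1 - s) *\<^sub>R T (z n))"
  have Z_0: "Z 0 = z0" by (simp add: Z_def)
  have Z_Suc: "Z (Suc j) n = s *\<^sub>R z0 n + (1 - s) *\<^sub>R T (Z j n)" for j n by (simp add: Z_def)
  have ZK: "Z j n \<in> K" for j n
  proof (induction j)
    case (Suc j)
    then show ?case unfolding Z_Suc using s z0 T_in by (intro convexD[OF K_convex]) auto
  qed (simp add: Z_0 z0)
  have step: "N (Z (Suc j) n - Z j n) \<le> (1 - s) ^ j * diam" for j n
  proof (induction j)
    case 0
    have "Z (Suc 0) n - Z 0 n = (1 - s) *\<^sub>R (T (z0 n) - z0 n)"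
      by (simp add: Z_Suc Z_0 algebra_simps)
    then have "N (Z (Suc 0) n - Z 0 n) = (1 - s) * N (T (z0 n) - z0 n)" using s by (simp add: N_scaleR)
    also have "\<dots> \<le> 1 * diam" using s z0 T_in by (intro mult_mono le_diam) auto
    finally show ?case by simp
  next
    case (Suc j)
    have "Z (Suc (Suc j)) n - Z (Suc j) n = (1 - s) *\<^sub>R (T (Z (Suc j) n) - T (Z j n))"
      unfolding Z_Suc[of "Suc j"] by (subst (2) Z_Suc) (simp add: algebra_simps)
    then have "N (Z (Suc (Suc j)) n - Z (Suc j) n) = (1 - s) * N (T (Z (Suc j) n) - T (Z j n))"
      using s by (simp add: N_scaleR)
    also have "\<dots> \<le> (1 - s) * ((1 - s) ^ j * diam)"
      using s nonexpansive[OF ZK ZK, of "Suc j" n j n] Suc by (intro mult_left_mono) auto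
    finally show ?case by simp
  qed
  obtain j where j: "(1 - s) ^ j < \<delta> / (2 * (diam + 1))"
    using real_arch_pow_inv[of "\<delta> / (2 * (diam + 1))" "1 - s"] s \<delta> d1 by auto
  have "N (T (Z j n) - Z j n) < \<delta>" for n
  proof -
    have small: "r * diam < \<delta> / 2" if "r \<le> \<delta> / (2 * (diam + 1))" for r
    proof -
      have "r * diam \<le> \<delta> / (2 * (diam + 1)) * diam"
        using that diam_nonneg by (rule mult_right_mono)
      also have "\<dots> < \<delta> / (2 * (diam + 1)) * (diam + 1)"
        using \<delta> d1 by (intro mult_strict_left_mono) auto
      also have "\<dots> = \<delta> / 2" using d1 by (simp add: field_simps)
      finally show ?thesis .
    qed
    have "T (Z j n) - Z (Suc j) n = s *\<^sub>R (T (Z j n) - z0 n)"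
      by (simp add: Z_Suc algebra_simps)
    then have "N (T (Z j n) - Z (Suc j) n) = s * N (T (Z j n) - z0 n)" using s by (simp add: N_scaleR)
    also have "\<dots> \<le> s * diam" using s ZK z0 T_in by (intro mult_left_mono le_diam) auto
    also have "\<dots> < \<delta> / 2" by (rule small) (simp add: s_def)
    finally have 1: "N (T (Z j n) - Z (Suc j) n) < \<delta> / 2" .
    have 2: "(1 - s) ^ j * diam < \<delta> / 2" using j by (intro small) simp
    show ?thesis
      using N_triangle_sub[of "T (Z j n)" "Z j n" "Z (Suc j) n"] step[of j n] 1 2 by linarith
  qed
  moreover have "N (Z j n - Z j m) \<le> t" if t: "\<forall>n m. N (z0 n - z0 m) \<le> t" for t n m
  proof (induction j)
    case (Suc j)
    have "Z (Suc j) n - Z (Suc j) m = s *\<^sub>R (z0 n - z0 m) + (1 - s) *\<^sub>R (T (Z j n) - T (Z j m))"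
      by (simp add: Z_Suc algebra_simps)
    also have "N \<dots> \<le> s * t + (1 - s) * t"
      using s t Suc nonexpansive[OF ZK ZK, of j n j m] by (intro N_convex) auto
    finally show ?case by (simp add: algebra_simps)
  qed (simp add: Z_0 t)
  moreover have "N (Z j n - x) \<le> N (z0 n - x) + real j * N (T x - x)" if x: "x \<in> K" for n x
  proof (induction j)
    case (Suc j)
    let ?b = "N (z0 n - x) + real (Suc j) * N (T x - x)"
    have "N (T (Z j n) - x) \<le> N (T (Z j n) - T x) + N (T x - x)" by (rule N_triangle_sub)
    also have "\<dots> \<le> ?b" using nonexpansive[OF ZK x, of j n] Suc by (simp add: algebra_simps)
    finally have "N (s *\<^sub>R (z0 n - x) + (1 - s) *\<^sub>R (T (Z j n) - x)) \<le> s * ?b + (1 - s) * ?b"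
      using s by (intro N_convex) auto
    then show ?case by (simp add: Z_Suc algebra_simps)
  qed (simp add: Z_0)
  ultimately show ?thesis using ZK by blast
qed

text \<open>A constant starting sequence already yields almost fixed points of any precision; weak
  closedness of \<open>K\<close> keeps the weak limit in \<open>K\<close>.\<close>

lemma approximate_fixed_point_sequence:
  "\<exists>x p. (\<forall>n. x n \<in> K) \<and> p \<in> K \<and> wconv V x p \<and> (\<lambda>n. N (T (x n) - x n)) \<longlonglongrightarrow> 0"
proof -
  obtain w where "w \<in> K" using K_nonempty by blast
  then have "\<forall>n::nat. \<exists>x. x \<in> K \<and> N (T x - x) < inverse (real (Suc n))"
    using averaged_iterates[of "\<lambda>_. w"] by (metis inverse_positive_iff_positive of_nat_0_less_iff zero_less_Suc)
  then obtain X where X: "\<And>n::nat. X n \<in> K" "\<And>n. N (T (X n) - X n) < inverse (real (Suc n))"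
    by metis
  obtain \<sigma> p where \<sigma>: "strict_mono \<sigma>" "wconv V (X \<circ> \<sigma>) p"
    "\<And>F. closedin W F \<Longrightarrow> range X \<subseteq> F \<Longrightarrow> p \<in> F"
    using weakly_convergent_subsequence[of X] X(1) K_subset by blast
  have "(\<lambda>n. N (T (X n) - X n)) \<longlonglongrightarrow> 0"
    by (rule tendsto_sandwich[OF _ _ tendsto_const LIMSEQ_inverse_real_of_nat])
      (use X(2) in \<open>auto intro!: always_eventually less_imp_le\<close>)
  then have "(\<lambda>n. N (T ((X \<circ> \<sigma>) n) - (X \<circ> \<sigma>) n)) \<longlonglongrightarrow> 0"
    using LIMSEQ_subseq_LIMSEQ[OF _ \<sigma>(1)] by (fastforce simp: comp_def)
  moreover have "p \<in> K" using \<sigma>(3)[OF K_closed] X(1) by blast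
  ultimately show ?thesis using \<sigma>(2) X(1) by (intro exI[of _ "X \<circ> \<sigma>"] exI[of _ p]) simp
qed

text \<open>\<open>z0 n\<close> divides the segment from \<open>p\<close> to \<open>x n\<close> in
  proportion \<open>\<tau> / diam\<close>, which gives the two distance bounds. Averaging preserves
  them up to \<open>e\<close>, and the Goebel--Karlovitz lemma supplies the lower bound.\<close>

lemma lin_sequence:
  assumes x: "\<And>n. x n \<in> K" and p: "p \<in> K" and afp: "(\<lambda>n. N (T (x n) - x n)) \<longlonglongrightarrow> 0"
    and \<tau>: "0 \<le> \<tau>" "\<tau> \<le> diam" and d: "0 < diam" and e: "e > 0"
  shows "\<exists>z \<sigma> u. strict_mono \<sigma> \<and> (\<forall>n. z n \<in> K) \<and> u \<in> C \<and> wconv V z u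
    \<and> (\<forall>n m. N (z n - z m) \<le> \<tau>) \<and> (\<forall>n. N (z n - x (\<sigma> n)) \<le> diam - \<tau> + e)
    \<and> (\<forall>n. diam - e < N (z n - p))"
proof -
  obtain \<delta> where \<delta>: "\<delta> > 0" "\<And>x. x \<in> K \<Longrightarrow> N (T x - x) < \<delta> \<Longrightarrow> diam - e < N (x - p)"
    using goebel_karlovitz[OF p e] by blast
  define a where "a = \<tau> / diam"
  have a: "0 \<le> a" "a \<le> 1" "a * diam = \<tau>" using \<tau> d by (auto simp: a_def)
  define z0 where "z0 = (\<lambda>n. (1 - a) *\<^sub>R p + a *\<^sub>R x n)"
  have z0K: "z0 n \<in> K" for n
    unfolding z0_def using a x p by (intro convexD[OF K_convex]) auto
  obtain z j where z: "\<And>n. z n \<in> K" "\<And>n. N (T (z n) - z n) < \<delta>"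
    "\<And>t. (\<forall>n m. N (z0 n - z0 m) \<le> t) \<Longrightarrow> \<forall>n m. N (z n - z m) \<le> t"
    "\<And>n x. x \<in> K \<Longrightarrow> N (z n - x) \<le> N (z0 n - x) + real j * N (T x - x)"
    using averaged_iterates[of z0, OF z0K \<delta>(1)] by blast
  have "N (z0 n - z0 m) \<le> \<tau>" for n m
  proof -
    have "z0 n - z0 m = a *\<^sub>R (x n - x m)" by (simp add: z0_def algebra_simps)
    then have "N (z0 n - z0 m) = a * N (x n - x m)" using a by (simp add: N_scaleR)
    also have "\<dots> \<le> a * diam" by (intro mult_left_mono le_diam x a)
    finally show ?thesis using a by simp
  qed
  then have z\<tau>: "N (z n - z m) \<le> \<tau>" for n m using z(3) by blast
  have z0x: "N (z0 n - x n) \<le> diam - \<tau>" for n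
  proof -
    have "z0 n - x n = (1 - a) *\<^sub>R (p - x n)" by (simp add: z0_def algebra_simps)
    then have "N (z0 n - x n) = (1 - a) * N (p - x n)" using a by (simp add: N_scaleR)
    also have "\<dots> \<le> (1 - a) * diam" using a by (intro mult_left_mono le_diam x p) auto
    finally show ?thesis using a by (simp add: algebra_simps)
  qed
  \<comment> \<open>As \<open>j\<close> does not depend on \<open>n\<close>, its contribution is
    below \<open>e\<close> once the first \<open>n0\<close> terms are discarded.\<close>
  have "(\<lambda>n. real j * N (T (x n) - x n)) \<longlonglongrightarrow> real j * 0" by (intro tendsto_mult tendsto_const afp)
  then have "\<forall>\<^sub>F n in sequentially. real j * N (T (x n) - x n) < e"
    using e by (intro order_tendstoD) auto
  then obtain n0 where n0: "\<And>n. n \<ge> n0 \<Longrightarrow> real j * N (T (x n) - x n) < e"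
    by (auto simp: eventually_sequentially)
  obtain \<sigma> u where \<sigma>: "strict_mono \<sigma>" "u \<in> C" "wconv V ((\<lambda>n. z (n + n0)) \<circ> \<sigma>) u"
    using weakly_convergent_subsequence[of "\<lambda>n. z (n + n0)"] z(1) K_subset by blast
  define \<rho> where "\<rho> = (\<lambda>n. \<sigma> n + n0)"
  have "strict_mono \<rho>" using \<sigma>(1) by (simp add: \<rho>_def strict_mono_def)
  moreover have "wconv V (\<lambda>n. z (\<rho> n)) u" using \<sigma>(3) by (simp add: \<rho>_def comp_def)
  moreover have "N (z (\<rho> n) - x (\<rho> n)) \<le> diam - \<tau> + e" for n
    using z(4)[OF x, of "\<rho> n" "\<rho> n"] z0x[of "\<rho> n"] n0[of "\<rho> n"] by (simp add: \<rho>_def)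
  moreover have "diam - e < N (z (\<rho> n) - p)" for n using \<delta>(2) z by blast
  ultimately show ?thesis
    using z(1) z\<tau> \<sigma>(2) by (intro exI[of _ "\<lambda>n. z (\<rho> n)"] exI[of _ \<rho>] exI[of _ u]) auto
qed

end

section \<open>The modulus R(a, X)\<close>

context norm_fun
begin

text \<open>The zero vector with the zero sequence is admissible. This excludes the value minus
  infinity in the quotient defining \<open>M_const\<close>.\<close>

lemma R_const_nonneg:
  assumes "0 \<in> V" "0 \<le> a"
  shows "0 \<le> R_const a V N"
proof -
  have "f 0 = 0" if "f \<in> dual_fun V N" for f
  proof -
    have "f (0 *\<^sub>R 0) = 0 * f 0" using that assms(1) unfolding dual_fun_def by blast
    then show ?thesis by simp
  qed
  then have "weakly_null V N (\<lambda>_. 0)"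
    using assms(1) tendsto_const[of "0::real" sequentially] unfolding weakly_null_def by force
  moreover have "Limsup sequentially (\<lambda>n::nat. Limsup sequentially (\<lambda>m::nat. ereal (N (0 - 0)))) \<le> 1"
    by (simp add: Limsup_const)
  ultimately have "(0, \<lambda>_. 0) \<in> {(x, xs). x \<in> V \<and> N x \<le> a \<and> weakly_null V N xs
        \<and> (\<forall>n. N (xs n) \<le> 1)
        \<and> Limsup sequentially (\<lambda>n. Limsup sequentially (\<lambda>m. ereal (N (xs n - xs m)))) \<le> 1}"
    using assms by simp
  then show ?thesis
    unfolding R_const_def by (rule SUP_upper2) (simp add: Liminf_const)
qed

text \<open>Converts the inequality between extended reals into a real gap \<open>\<rho>\<close> at
  one parameter \<open>a\<close>. An infinite \<open>R_const\<close> would make the quotient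
  0.\<close>

lemma M_const_gt_1D:
  assumes "0 \<in> V" "1 < M_const V N"
  shows "\<exists>a \<rho>. 0 \<le> a \<and> 0 < \<rho> \<and> R_const a V N \<le> ereal (1 + a - \<rho>)"
proof -
  obtain a where a: "a \<ge> 0" "1 < ereal (1 + a) / R_const a V N"
    using assms(2) unfolding M_const_def less_SUP_iff by auto
  have R: "0 \<le> R_const a V N" using R_const_nonneg[OF assms(1) a(1)] .
  show ?thesis
  proof (cases "R_const a V N")
    case (real r)
    have "r < 1 + a"
    proof (rule ccontr)
      assume "\<not> r < 1 + a"
      then have "ereal (1 + a) / R_const a V N \<le> 1"
        using a(1) by (auto simp: real divide_simps)
      then show False using a(2) by simp
    qed
    then show ?thesis using a(1) real by (intro exI[of _ a] exI[of _ "1 + a - r"]) simp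
  next
    case PInf
    then show ?thesis using a(2) by simp
  next
    case MInf
    then show ?thesis using R by simp
  qed
qed

text \<open>Split \<open>z n\<close> into \<open>\<mu> (v n + x)\<close>,
  \<open>(\<delta> - \<mu>) v n\<close> and a multiple of \<open>u\<close> of norm
  \<open>N u - a \<mu>\<close>, where \<open>v n = (z n - u) / \<delta>\<close> and \<open>x\<close>
  is \<open>u\<close> rescaled to norm \<open>a\<close>. The pair \<open>x\<close>, \<open>v\<close>
  is admissible in \<open>R_const\<close>, so the first part saves \<open>\<rho> \<mu>\<close> over
  the triangle inequality.\<close>

lemma R_const_bound:
  assumes "subspace V" and R: "R_const a V N \<le> ereal (1 + a - \<rho>)" and a: "0 \<le> a"
    and z: "\<And>n. z n \<in> V" "u \<in> V" "wconv V z u"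
    and \<delta>: "0 < \<delta>" "\<And>n. \<forall>\<^sub>F m in sequentially. N (z n - z m) \<le> \<delta>"
    and \<mu>: "0 \<le> \<mu>" "\<mu> \<le> \<delta>" "a * \<mu> \<le> N u"
    and e: "(\<lambda>n. N (z n)) \<longlonglongrightarrow> e"
  shows "e \<le> \<delta> + N u - \<rho> * \<mu>"
proof -
  have zu: "N (z n - u) \<le> \<delta>" for n
  proof -
    have "\<forall>\<^sub>F m in sequentially. N (z m - z n) \<le> \<delta>"
      using \<delta>(2)[of n] by (simp add: N_minus_commute)
    then show ?thesis
      using wconv_dist_le[OF z(3) wconv_const, of "z n" \<delta>] by (simp add: N_minus_commute)
  qed
  define v where "v = (\<lambda>n. (1 / \<delta>) *\<^sub>R (z n - u))"
  \<comment> \<open>For \<open>u = 0\<close> division by zero gives \<open>x = 0\<close>, and the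
    decomposition still holds.\<close>
  define x where "x = (a / N u) *\<^sub>R u"
  have v1: "N (v n) \<le> 1" for n using zu[of n] \<delta>(1) by (simp add: v_def N_scaleR)
  have Nx: "N x \<le> a" using a by (simp add: x_def N_scaleR)
  have decomp: "N (z n) \<le> \<mu> * N (v n + x) + (\<delta> - \<mu>) + (N u - a * \<mu>)" for n
  proof -
    have "z n = \<delta> *\<^sub>R v n + u" using \<delta>(1) by (simp add: v_def)
    moreover have "\<mu> *\<^sub>R (v n + x) + ((\<delta> - \<mu>) *\<^sub>R v n + (u - \<mu> *\<^sub>R x)) = \<delta> *\<^sub>R v n + u"
      by (simp add: algebra_simps)
    moreover have "((N u - a * \<mu>) / N u) *\<^sub>R u = u - \<mu> *\<^sub>R x"
      using N_eq_0[of u] by (cases "N u = 0") (auto simp: x_def diff_divide_distrib scaleR_diff_left)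
    ultimately have "z n = \<mu> *\<^sub>R (v n + x) + ((\<delta> - \<mu>) *\<^sub>R v n + ((N u - a * \<mu>) / N u) *\<^sub>R u)"
      by simp
    then have "N (z n) \<le> N (\<mu> *\<^sub>R (v n + x)) + (N ((\<delta> - \<mu>) *\<^sub>R v n) + N (((N u - a * \<mu>) / N u) *\<^sub>R u))"
      by (metis N_triangle add_left_mono order_trans)
    moreover have "N ((\<delta> - \<mu>) *\<^sub>R v n) \<le> \<delta> - \<mu>"
      using \<mu>(2) v1[of n] mult_left_mono[of "N (v n)" 1 "\<delta> - \<mu>"] by (simp add: N_scaleR)
    moreover have "N (((N u - a * \<mu>) / N u) *\<^sub>R u) \<le> N u - a * \<mu>"
      using \<mu>(3) by (simp add: N_scaleR)
    ultimately show ?thesis using \<mu>(1) by (simp add: N_scaleR)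
  qed
  have wn: "weakly_null V N v"
    unfolding weakly_null_def
  proof (intro conjI allI ballI)
    show "v n \<in> V" for n
      unfolding v_def using assms(1) z by (intro subspace_scale subspace_diff)
    fix f assume f: "f \<in> dual_fun V N"
    have "f (v n) = (1 / \<delta>) * (f (z n) - f u)" for n
    proof -
      have "z n - u \<in> V" using assms(1) z by (intro subspace_diff)
      then have "f (v n) = (1 / \<delta>) * f (z n - u)"
        using f unfolding v_def dual_fun_def by blast
      then show ?thesis using dual_fun_diff[OF f assms(1) z(1) z(2)] by simp
    qed
    moreover have "(\<lambda>n. (1 / \<delta>) * (f (z n) - f u)) \<longlonglongrightarrow> (1 / \<delta>) * (f u - f u)"
      using z(3) f by (intro tendsto_intros) (simp add: wconv_def)
    ultimately show "(\<lambda>n. f (v n)) \<longlonglongrightarrow> 0" by simp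
  qed
  have "Limsup sequentially (\<lambda>m. ereal (N (v n - v m))) \<le> 1" for n
  proof (rule Limsup_bounded)
    show "\<forall>\<^sub>F m in sequentially. ereal (N (v n - v m)) \<le> 1"
      using \<delta>(2)[of n]
    proof eventually_elim
      case (elim m)
      have "v n - v m = (1 / \<delta>) *\<^sub>R (z n - z m)" by (simp add: v_def algebra_simps)
      then show ?case using elim \<delta>(1) by (simp add: N_scaleR)
    qed
  qed
  then have "Limsup sequentially (\<lambda>n. Limsup sequentially (\<lambda>m. ereal (N (v n - v m)))) \<le> 1"
    by (intro Limsup_bounded) auto
  then have "(x, v) \<in> {(x, xs). x \<in> V \<and> N x \<le> a \<and> weakly_null V N xs
        \<and> (\<forall>n. N (xs n) \<le> 1)
        \<and> Limsup sequentially (\<lambda>n. Limsup sequentially (\<lambda>m. ereal (N (xs n - xs m)))) \<le> 1}"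
    using wn v1 Nx assms(1) z(2) by (simp add: x_def subspace_scale)
  then have "Liminf sequentially (\<lambda>n. ereal (N (snd (x, v) n + fst (x, v)))) \<le> R_const a V N"
    unfolding R_const_def by (rule SUP_upper)
  then have L: "Liminf sequentially (\<lambda>n. ereal (N (v n + x))) \<le> ereal (1 + a - \<rho>)"
    using R by (simp add: order_trans)
  show ?thesis
  proof (rule ccontr)
    assume neg: "\<not> e \<le> \<delta> + N u - \<rho> * \<mu>"
    \<comment> \<open>The modulus bounds only a liminf, but \<open>N (z n)\<close> converges: an
      excess \<open>\<kappa>\<close> in its limit would push \<open>N (v n + x)\<close> above the
      bound for all large \<open>n\<close>.\<close>
    define \<kappa> where "\<kappa> = e - (\<delta> + N u - \<rho> * \<mu>)"
    have \<kappa>: "\<kappa> > 0" using neg by (simp add: \<kappa>_def)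
    have ev: "\<forall>\<^sub>F n in sequentially. e - \<kappa> / 2 < N (z n)"
      using e \<kappa> by (intro order_tendstoD(1)[OF e]) simp
    show False
    proof (cases "\<mu> = 0")
      case True
      have le: "N (z n) \<le> \<delta> + N u" for n using decomp[of n] True by simp
      obtain n where "e - \<kappa> / 2 < N (z n)"
        using eventually_happens[OF ev] by auto
      then have "e - \<kappa> / 2 < \<delta> + N u" using le[of n] by linarith
      then show False using \<kappa> True by (simp add: \<kappa>_def field_simps)
    next
      case False
      then have \<mu>0: "\<mu> > 0" using \<mu>(1) by simp
      have "\<forall>\<^sub>F n in sequentially. ereal (1 + a - \<rho> + \<kappa> / (2 * \<mu>)) \<le> ereal (N (v n + x))"
        using ev
      proof eventually_elim
        case (elim n)
        have "e = \<delta> + N u - \<rho> * \<mu> + \<kappa>" by (simp add: \<kappa>_def)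
        then have "\<kappa> / 2 + \<mu> * (1 + a - \<rho>) \<le> \<mu> * N (v n + x)"
          using elim decomp[of n] by (simp add: algebra_simps)
        then show ?case using \<mu>0 by (simp add: field_simps)
      qed
      then have "ereal (1 + a - \<rho> + \<kappa> / (2 * \<mu>)) \<le> Liminf sequentially (\<lambda>n. ereal (N (v n + x)))"
        by (rule Liminf_bounded)
      also note L
      finally have "ereal (1 + a - \<rho> + \<kappa> / (2 * \<mu>)) \<le> ereal (1 + a - \<rho>)" .
      then have "\<kappa> / (2 * \<mu>) \<le> 0" by simp
      moreover have "\<kappa> / (2 * \<mu>) > 0" using \<kappa> \<mu>0 by simp
      ultimately show False by simp
    qed
  qed
qed

end

interpretation norm: norm_fun "norm :: 'a::real_normed_vector \<Rightarrow> real"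
  by unfold_locales (auto simp: norm_triangle_ineq)

section \<open>Strictly monotone absolute norms\<close>

lemma bounded_componentwise:
  fixes Y :: "'b \<Rightarrow> real^'n::finite"
  assumes "\<And>k i. \<bar>Y k $ i\<bar> \<le> r"
  shows "bounded (range Y)"
proof -
  have "norm (Y k) \<le> (\<Sum>i\<in>(UNIV::'n set). r)" for k
    using norm_le_l1_cart[of "Y k"] sum_mono[of UNIV "\<lambda>i. \<bar>Y k $ i\<bar>" "\<lambda>_. r"] assms by fastforce
  then show ?thesis by (auto simp: bounded_iff)
qed

locale strictly_monotone_absolute_norm =
  fixes \<psi> :: "real^'n::finite \<Rightarrow> real"
  assumes is_norm: "is_norm_on_Rn \<psi>" and absolute: "absolute_norm \<psi>"
    and normalized: "normalized_norm \<psi>" and strictly_monotone: "strictly_monotone_norm \<psi>"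
begin

sublocale norm_fun \<psi>
  using is_norm by unfold_locales (auto simp: is_norm_on_Rn_def)

lemma psi_strict_mono:
  assumes "\<And>i. \<bar>x $ i\<bar> \<le> \<bar>y $ i\<bar>" "\<bar>x $ j\<bar> < \<bar>y $ j\<bar>"
  shows "\<psi> x < \<psi> y"
  using strictly_monotone assms unfolding strictly_monotone_norm_def by blast

text \<open>If no coordinate is strictly larger, the absolute values agree and absoluteness gives
  equality.\<close>

lemma psi_mono:
  assumes "\<And>i. \<bar>x $ i\<bar> \<le> \<bar>y $ i\<bar>"
  shows "\<psi> x \<le> \<psi> y"
proof (cases "\<exists>j. \<bar>x $ j\<bar> < \<bar>y $ j\<bar>")
  case True
  then show ?thesis using psi_strict_mono assms less_imp_le by blast
next
  case False
  then have "(\<chi> i. \<bar>x $ i\<bar>) = (\<chi> i. \<bar>y $ i\<bar>)"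
    using assms by (simp add: vec_eq_iff) (meson antisym not_less)
  then show ?thesis
    using absolute unfolding absolute_norm_def by (metis order_refl)
qed

lemma psi_component_le: "\<bar>x $ i\<bar> \<le> \<psi> x"
proof -
  have "axis i (x $ i) = (x $ i) *\<^sub>R axis i 1" by (simp add: vec_eq_iff axis_def)
  then have "\<bar>x $ i\<bar> = \<psi> (axis i (x $ i))"
    using normalized by (simp add: N_scaleR normalized_norm_def)
  also have "\<dots> \<le> \<psi> x" by (intro psi_mono) (simp add: axis_def)
  finally show ?thesis .
qed

text \<open>A norm is convex, and convex functions on a finite-dimensional space are
  continuous.\<close>

lemma tendsto_psi:
  assumes "(X \<longlongrightarrow> l) F"
  shows "((\<lambda>n. \<psi> (X n)) \<longlongrightarrow> \<psi> l) F"
proof -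
  have "convex_on UNIV \<psi>"
    by (rule convex_onI) (use N_convex in auto)
  then have "continuous_on UNIV \<psi>" by (intro convex_on_continuous) auto
  then show ?thesis
    using assms continuous_on_tendsto_compose[of UNIV \<psi> X l F] by simp
qed

lemma norm_fun_psi_sum: "norm_fun (psi_sum_norm \<psi> :: ('a::real_normed_vector^'n) \<Rightarrow> real)"
proof
  fix x y :: "'a^'n" and c :: real
  have "psi_sum_norm \<psi> (x + y) \<le> \<psi> ((\<chi> i. norm (x $ i)) + (\<chi> i. norm (y $ i)))"
    unfolding psi_sum_norm_def by (intro psi_mono) (simp add: norm_triangle_ineq)
  also have "\<dots> \<le> psi_sum_norm \<psi> x + psi_sum_norm \<psi> y"
    unfolding psi_sum_norm_def by (rule N_triangle)
  finally show "psi_sum_norm \<psi> (x + y) \<le> psi_sum_norm \<psi> x + psi_sum_norm \<psi> y" .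
  have "(\<chi> i. norm ((c *\<^sub>R x) $ i)) = \<bar>c\<bar> *\<^sub>R (\<chi> i. norm (x $ i))"
    by (simp add: vec_eq_iff)
  then show "psi_sum_norm \<psi> (c *\<^sub>R x) = \<bar>c\<bar> * psi_sum_norm \<psi> x"
    unfolding psi_sum_norm_def by (simp add: N_scaleR)
  assume "psi_sum_norm \<psi> x = 0"
  then have "(\<chi> i. norm (x $ i)) = 0" unfolding psi_sum_norm_def by (rule N_eq_0)
  then show "x = 0" by (simp add: vec_eq_iff)
qed

lemma component_le_psi_sum: "norm (x $ i) \<le> psi_sum_norm \<psi> x"
  unfolding psi_sum_norm_def using psi_component_le[of "\<chi> i. norm (x $ i)" i] by simp

lemma component_dual_fun:
  assumes f: "f \<in> dual_fun (S i) norm"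
  shows "(\<lambda>x. f (x $ i)) \<in> dual_fun (psi_sum_carrier S) (psi_sum_norm \<psi>)"
proof -
  obtain k where k: "\<And>x. x \<in> S i \<Longrightarrow> \<bar>f x\<bar> \<le> k * norm x"
    using f unfolding dual_fun_def by blast
  \<comment> \<open>The constant in \<open>dual_fun\<close> may be negative, so its absolute value
    is taken before \<open>norm\<close> is enlarged.\<close>
  have "\<bar>f (x $ i)\<bar> \<le> \<bar>k\<bar> * psi_sum_norm \<psi> x" if "x \<in> psi_sum_carrier S" for x
  proof -
    have "\<bar>f (x $ i)\<bar> \<le> k * norm (x $ i)" using that k by (simp add: psi_sum_carrier_def)
    also have "\<dots> \<le> \<bar>k\<bar> * psi_sum_norm \<psi> x"
      by (intro mult_mono component_le_psi_sum) auto
    finally show ?thesis .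
  qed
  then show ?thesis using f unfolding dual_fun_def psi_sum_carrier_def by auto
qed

lemma component_wconv:
  assumes "norm_fun.wconv (psi_sum_norm \<psi>) (psi_sum_carrier S) z u"
  shows "norm.wconv (S i) (\<lambda>n. z n $ i) (u $ i)"
  unfolding norm.wconv_def
proof
  fix f assume "f \<in> dual_fun (S i) norm"
  from component_dual_fun[of f S i, OF this] show "(\<lambda>n. f (z n $ i)) \<longlonglongrightarrow> f (u $ i)"
    using assms unfolding norm_fun.wconv_def[OF norm_fun_psi_sum] by fast
qed

text \<open>With equality throughout \<open>\<psi> e \<le> \<psi> (\<delta> + \<zeta>) \<le> \<psi> \<delta> + \<psi> \<zeta>\<close>, strict monotonicity turns the
  componentwise estimates into equalities, and each component has \<open>\<delta> = 0\<close> or \<open>\<zeta> = 0\<close>.\<close>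

lemma extremal_components:
  fixes \<delta> \<zeta> \<eta> e c :: "real^'n" and a \<rho> :: "'n \<Rightarrow> real"
  assumes a: "\<And>i. 0 \<le> a i" and \<rho>: "\<And>i. 0 < \<rho> i"
    and nn: "\<And>i. 0 \<le> \<delta> $ i" "\<And>i. 0 \<le> \<zeta> $ i" "\<And>i. 0 \<le> e $ i"
    and le: "\<And>i. e $ i \<le> \<delta> $ i + \<zeta> $ i - \<rho> i * min (\<delta> $ i) (\<zeta> $ i / (a i + 1))"
    and \<zeta>\<eta>: "\<And>i. \<zeta> $ i \<le> \<eta> $ i"
    and psi: "\<psi> \<eta> \<le> d - \<tau>" "\<psi> \<delta> \<le> \<tau>" "d \<le> \<psi> e"
    and c: "\<And>i. \<bar>e $ i - c $ i\<bar> \<le> \<eta> $ i"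
  shows "\<exists>A. \<psi> (\<chi> i. if i \<in> A then c $ i else 0) = \<tau>"
proof -
  \<comment> \<open>This minimum meets both requirements on \<open>\<mu>\<close> in
    \<open>R_const_bound\<close>: it is at most \<open>\<delta>\<close>, and \<open>a\<close> times
    it is at most \<open>\<zeta>\<close>. The \<open>+ 1\<close> covers
    \<open>a i = 0\<close>.\<close>
  define m where "m = (\<lambda>i. min (\<delta> $ i) (\<zeta> $ i / (a i + 1)))"
  have m: "0 \<le> m i" for i using nn[of i] a[of i] by (simp add: m_def)
  have e_le: "e $ i \<le> (\<delta> + \<zeta>) $ i - \<rho> i * m i" for i using le[of i] by (simp add: m_def)
  have \<zeta>\<eta>': "\<psi> \<zeta> \<le> \<psi> \<eta>" using nn order_trans[OF \<zeta>\<eta> abs_ge_self] by (intro psi_mono) simp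
  have sum: "\<psi> (\<delta> + \<zeta>) \<le> \<psi> \<delta> + \<psi> \<zeta>" by (rule N_triangle)
  have m0: "m i = 0" and e_eq: "e $ i = \<delta> $ i + \<zeta> $ i" for i
  proof -
    have abs_le: "\<bar>e $ j\<bar> \<le> \<bar>(\<delta> + \<zeta>) $ j\<bar>" for j
      using e_le[of j] nn[of j] mult_nonneg_nonneg[OF less_imp_le[OF \<rho>] m, of j j] by simp
    have "\<not> \<bar>e $ i\<bar> < \<bar>(\<delta> + \<zeta>) $ i\<bar>"
    proof
      assume "\<bar>e $ i\<bar> < \<bar>(\<delta> + \<zeta>) $ i\<bar>"
      from psi_strict_mono[OF abs_le this] show False using sum \<zeta>\<eta>' psi by linarith
    qed
    then have *: "\<delta> $ i + \<zeta> $ i \<le> e $ i" using nn[of i] by simp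
    then have "\<rho> i * m i \<le> 0" using e_le[of i] by simp
    then show "m i = 0" using m[of i] \<rho>[of i] by (simp add: mult_le_0_iff)
    then show "e $ i = \<delta> $ i + \<zeta> $ i" using * e_le[of i] by simp
  qed
  have \<zeta>_eq: "\<zeta> $ i = \<eta> $ i" for i
  proof (rule ccontr)
    assume "\<zeta> $ i \<noteq> \<eta> $ i"
    then have "\<bar>\<zeta> $ i\<bar> < \<bar>\<eta> $ i\<bar>" using \<zeta>\<eta>[of i] nn[of i] by simp
    moreover have "\<bar>\<zeta> $ j\<bar> \<le> \<bar>\<eta> $ j\<bar>" for j using \<zeta>\<eta>[of j] nn[of j] by simp
    ultimately have "\<psi> \<zeta> < \<psi> \<eta>" by (intro psi_strict_mono)
    moreover have "\<psi> e = \<psi> (\<delta> + \<zeta>)" using e_eq by (intro arg_cong[of _ _ \<psi>]) (simp add: vec_eq_iff)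
    ultimately show False using sum psi by linarith
  qed
  \<comment> \<open>Where \<open>\<zeta>\<close> vanishes so does \<open>\<eta>\<close>, whence
    \<open>\<delta> = e = c\<close>; elsewhere the vanishing minimum forces
    \<open>\<delta> = 0\<close>.\<close>
  have "\<delta> = (\<chi> i. if i \<in> {i. \<zeta> $ i = 0} then c $ i else 0)"
  proof (simp add: vec_eq_iff, intro allI conjI impI)
    fix i assume "\<zeta> $ i = 0"
    then show "\<delta> $ i = c $ i" using c[of i] \<zeta>_eq[of i] e_eq[of i] by simp
  next
    fix i assume "\<zeta> $ i \<noteq> 0"
    then have "\<zeta> $ i / (a i + 1) > 0" using nn(2)[of i] a[of i] by (simp add: zero_less_divide_iff)
    then show "\<delta> $ i = 0" using m0[of i] by (simp add: m_def min_def split: if_splits)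
  qed
  moreover have "\<psi> \<delta> = \<tau>"
  proof -
    have "\<psi> e = \<psi> (\<delta> + \<zeta>)" using e_eq by (intro arg_cong[of _ _ \<psi>]) (simp add: vec_eq_iff)
    then show ?thesis using sum psi \<zeta>\<eta>' by linarith
  qed
  ultimately show ?thesis by metis
qed

text \<open>The slack \<open>inverse (real (Suc k))\<close> is removed by compactness in finite
  dimension; all conditions are closed, and \<open>c\<close> is the same for every
  \<open>k\<close>.\<close>

lemma extremal_components_limit:
  fixes \<delta> \<zeta> \<eta> e :: "nat \<Rightarrow> real^'n" and c :: "real^'n" and a \<rho> :: "'n \<Rightarrow> real"
  assumes a: "\<And>i. 0 \<le> a i" and \<rho>: "\<And>i. 0 < \<rho> i"
    and nn: "\<And>k i. 0 \<le> \<delta> k $ i" "\<And>k i. 0 \<le> \<zeta> k $ i" "\<And>k i. 0 \<le> e k $ i"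
    and le: "\<And>k i. e k $ i \<le> \<delta> k $ i + \<zeta> k $ i - \<rho> i * min (\<delta> k $ i) (\<zeta> k $ i / (a i + 1))"
    and \<zeta>\<eta>: "\<And>k i. \<zeta> k $ i \<le> \<eta> k $ i"
    and psi: "\<And>k. \<psi> (\<eta> k) \<le> d - \<tau> + inverse (real (Suc k))" "\<And>k. \<psi> (\<delta> k) \<le> \<tau>"
      "\<And>k. d - inverse (real (Suc k)) \<le> \<psi> (e k)"
    and c: "\<And>k i. \<bar>e k $ i - c $ i\<bar> \<le> \<eta> k $ i"
  shows "\<exists>A. \<psi> (\<chi> i. if i \<in> A then c $ i else 0) = \<tau>"
proof -
  \<comment> \<open>Packing the four vectors into one lets a single subsequence serve for
    all.\<close>
  define X where "X = (\<lambda>k. ((\<delta> k, \<zeta> k), (\<eta> k, e k)))"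
  define b where "b = \<bar>d\<bar> + \<bar>\<tau>\<bar> + 1"

  have \<eta>b: "\<bar>\<eta> k $ i\<bar> \<le> b" for k i
  proof -
    have "inverse (real (Suc k)) \<le> 1" by (simp add: inverse_le_1_iff)
    then show ?thesis using psi_component_le[of "\<eta> k" i] psi(1)[of k] by (simp add: b_def)
  qed
  have \<delta>b: "\<bar>\<delta> k $ i\<bar> \<le> b" for k i
    using psi_component_le[of "\<delta> k" i] psi(2)[of k] by (simp add: b_def)
  have \<zeta>b: "\<bar>\<zeta> k $ i\<bar> \<le> b" for k i
    using \<eta>b[of k i] \<zeta>\<eta>[of k i] nn(2)[of k i] by simp
  have eb: "\<bar>e k $ i\<bar> \<le> b + b" for k i
  proof -
    have "0 \<le> \<rho> i * min (\<delta> k $ i) (\<zeta> k $ i / (a i + 1))"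
      using nn[of k i] a[of i] \<rho>[of i] by (intro mult_nonneg_nonneg) auto
    then show ?thesis using le[of k i] nn[of k i] \<delta>b[of k i] \<zeta>b[of k i] by linarith
  qed
  have "range X \<subseteq> (range \<delta> \<times> range \<zeta>) \<times> (range \<eta> \<times> range e)" by (auto simp: X_def)
  moreover have "bounded ((range \<delta> \<times> range \<zeta>) \<times> (range \<eta> \<times> range e))"
    by (intro bounded_Times bounded_componentwise[OF \<eta>b] bounded_componentwise[OF \<delta>b]
        bounded_componentwise[OF \<zeta>b] bounded_componentwise[OF eb])
  ultimately have "bounded (range X)" by (rule bounded_subset[rotated])
  then obtain l \<sigma> where \<sigma>: "strict_mono \<sigma>" "(X \<circ> \<sigma>) \<longlonglongrightarrow> l"
    using bounded_imp_convergent_subsequence by blast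
  obtain \<delta>' \<zeta>' \<eta>' e' where l: "l = ((\<delta>', \<zeta>'), (\<eta>', e'))" by (metis prod.exhaust)
  have lim: "(\<lambda>k. \<delta> (\<sigma> k)) \<longlonglongrightarrow> \<delta>'" "(\<lambda>k. \<zeta> (\<sigma> k)) \<longlonglongrightarrow> \<zeta>'"
    "(\<lambda>k. \<eta> (\<sigma> k)) \<longlonglongrightarrow> \<eta>'" "(\<lambda>k. e (\<sigma> k)) \<longlonglongrightarrow> e'"
    using tendsto_fst[OF tendsto_fst[OF \<sigma>(2)]] tendsto_snd[OF tendsto_fst[OF \<sigma>(2)]]
      tendsto_fst[OF tendsto_snd[OF \<sigma>(2)]] tendsto_snd[OF tendsto_snd[OF \<sigma>(2)]]
    by (simp_all add: l X_def comp_def)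
  note limi = lim[THEN tendsto_vec_nth]
  have inv: "(\<lambda>k. inverse (real (Suc (\<sigma> k)))) \<longlonglongrightarrow> 0"
    using LIMSEQ_subseq_LIMSEQ[OF LIMSEQ_inverse_real_of_nat \<sigma>(1)] by (simp add: comp_def)
  show ?thesis
  proof (rule extremal_components[of a \<rho> \<delta>' \<zeta>' e' \<eta>' d \<tau> c])
    fix i
    show "0 \<le> \<delta>' $ i" by (rule LIMSEQ_le_const[OF limi(1)]) (use nn in auto)
    show "0 \<le> \<zeta>' $ i" by (rule LIMSEQ_le_const[OF limi(2)]) (use nn in auto)
    show "0 \<le> e' $ i" by (rule LIMSEQ_le_const[OF limi(4)]) (use nn in auto)
    show "\<zeta>' $ i \<le> \<eta>' $ i" by (rule LIMSEQ_le[OF limi(2) limi(3)]) (use \<zeta>\<eta> in auto)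
    show "\<bar>e' $ i - c $ i\<bar> \<le> \<eta>' $ i"
      by (rule LIMSEQ_le[OF tendsto_rabs[OF tendsto_diff[OF limi(4) tendsto_const]] limi(3)])
        (use c in auto)
    show "e' $ i \<le> \<delta>' $ i + \<zeta>' $ i - \<rho> i * min (\<delta>' $ i) (\<zeta>' $ i / (a i + 1))"
    proof (rule LIMSEQ_le[OF limi(4)])
      show "(\<lambda>k. \<delta> (\<sigma> k) $ i + \<zeta> (\<sigma> k) $ i
          - \<rho> i * min (\<delta> (\<sigma> k) $ i) (\<zeta> (\<sigma> k) $ i / (a i + 1)))
        \<longlonglongrightarrow> \<delta>' $ i + \<zeta>' $ i - \<rho> i * min (\<delta>' $ i) (\<zeta>' $ i / (a i + 1))"
        using a[of i] by (intro tendsto_intros tendsto_min limi) auto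
    qed (use le in auto)
  next
    have "(\<lambda>k. d - \<tau> + inverse (real (Suc (\<sigma> k)))) \<longlonglongrightarrow> d - \<tau> + 0" by (intro tendsto_intros inv)
    then have "\<psi> \<eta>' \<le> d - \<tau> + 0"
      by (rule LIMSEQ_le[OF tendsto_psi[OF lim(3)]]) (use psi(1) in auto)
    then show "\<psi> \<eta>' \<le> d - \<tau>" by simp
    show "\<psi> \<delta>' \<le> \<tau>" by (rule LIMSEQ_le_const2[OF tendsto_psi[OF lim(1)]]) (use psi(2) in auto)
    have "(\<lambda>k. d - inverse (real (Suc (\<sigma> k)))) \<longlonglongrightarrow> d - 0" by (intro tendsto_intros inv)
    then have "d - 0 \<le> \<psi> e'"
      by (rule LIMSEQ_le[OF _ tendsto_psi[OF lim(4)]]) (use psi(3) in auto)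
    then show "d \<le> \<psi> e'" by simp
  qed (use a \<rho> in auto)
qed

end

section \<open>Minimal invariant sets in direct sums\<close>

locale minimal_invariant_sum =
  strictly_monotone_absolute_norm \<psi> +
  sum: minimal_invariant_set "psi_sum_norm \<psi>" "psi_sum_carrier S" C T K
  for \<psi> :: "real^'n::finite \<Rightarrow> real" and S :: "'n \<Rightarrow> 'a::real_normed_vector set" and C T K +
  fixes a \<rho> :: "'n \<Rightarrow> real"
  assumes subspace_S: "\<And>i. subspace (S i)"
    and a: "\<And>i. 0 \<le> a i" and \<rho>: "\<And>i. 0 < \<rho> i"
    and R: "\<And>i. R_const (a i) (S i) norm \<le> ereal (1 + a i - \<rho> i)"
begin

lemma component_in: "x \<in> C \<Longrightarrow> x $ i \<in> S i"
  using sum.C_subset by (auto simp: psi_sum_carrier_def)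

lemma component_diff_le: "norm (x $ i - y $ i) \<le> psi_sum_norm \<psi> (x - y)" for x y :: "'a^'n"
  using component_le_psi_sum[of "x - y" i] by simp

lemma psi_diff: "\<psi> (\<chi> i. norm (x $ i - y $ i)) = psi_sum_norm \<psi> (x - y)" for x y :: "'a^'n"
  by (simp add: psi_sum_norm_def)

text \<open>Passes from \<open>lin_sequence\<close> to numbers: \<open>e\<close> and
  \<open>\<eta>\<close> are coordinatewise limits, \<open>\<delta>\<close> is an iterated limit of
  mutual distances, and \<open>R_const_bound\<close> in each coordinate gives the inequality with
  \<open>\<rho>\<close>.\<close>

lemma component_estimates:
  fixes c :: "real^'n"
  assumes x: "\<And>n. x n \<in> K" and p: "p \<in> K" and xp: "sum.wconv (psi_sum_carrier S) x p"
    and afp: "(\<lambda>n. psi_sum_norm \<psi> (T (x n) - x n)) \<longlonglongrightarrow> 0"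
    and c: "\<And>i. (\<lambda>n. norm (x n $ i - p $ i)) \<longlonglongrightarrow> c $ i"
    and \<tau>: "0 \<le> \<tau>" "\<tau> \<le> sum.diam" and d: "0 < sum.diam" and h: "h > 0"
  shows "\<exists>\<delta> \<zeta> \<eta> e :: real^'n.
    (\<forall>i. 0 \<le> \<delta> $ i \<and> 0 \<le> \<zeta> $ i \<and> 0 \<le> e $ i \<and> \<zeta> $ i \<le> \<eta> $ i \<and> \<bar>e $ i - c $ i\<bar> \<le> \<eta> $ i
      \<and> e $ i \<le> \<delta> $ i + \<zeta> $ i - \<rho> i * min (\<delta> $ i) (\<zeta> $ i / (a i + 1)))
    \<and> \<psi> \<eta> \<le> sum.diam - \<tau> + h \<and> \<psi> \<delta> \<le> \<tau> \<and> sum.diam - h \<le> \<psi> e"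
proof -
  obtain z \<sigma> u where \<sigma>: "strict_mono \<sigma>" and z: "\<And>n. z n \<in> K" and u: "u \<in> C"
    and zu: "sum.wconv (psi_sum_carrier S) z u"
    and zz: "\<And>n m. psi_sum_norm \<psi> (z n - z m) \<le> \<tau>"
    and zx: "\<And>n. psi_sum_norm \<psi> (z n - x (\<sigma> n)) \<le> sum.diam - \<tau> + h"
    and zp: "\<And>n. sum.diam - h < psi_sum_norm \<psi> (z n - p)"
    using sum.lin_sequence[OF x p afp \<tau> d h] by blast
  define Q where "Q = (\<lambda>n. (\<chi> i. norm (z n $ i - p $ i)) :: real^'n)"
  define H where "H = (\<lambda>n. (\<chi> i. norm (z n $ i - x (\<sigma> n) $ i)) :: real^'n)"
  define D where "D = (\<lambda>n m. (\<chi> i. norm (z n $ i - z m $ i)) :: real^'n)"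
  \<comment> \<open>One countable family collects \<open>Q\<close>, \<open>H\<close> and all rows
    \<open>D n\<close>, so one diagonal subsequence makes them all converge.\<close>
  define Y where "Y = (\<lambda>j. case j of 0 \<Rightarrow> Q | Suc 0 \<Rightarrow> H | Suc (Suc n) \<Rightarrow> D n)"
  have Y_simps: "Y 0 = Q" "Y (Suc 0) = H" "Y (Suc (Suc n)) = D n" for n
    by (simp_all add: Y_def)
  have comp_le: "norm (v $ i - w $ i) \<le> sum.diam" if "v \<in> K" "w \<in> K" for v w i
    using component_diff_le sum.le_diam[OF that] by (rule order_trans)
  have bdd: "bounded (range Q)" "bounded (range H)" "bounded (range (D n))" for n
    by (rule bounded_componentwise[where r = sum.diam],
        simp add: Q_def H_def D_def comp_le x z p)+
  have "bounded (range (Y j))" for j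
    unfolding Y_def using bdd by (simp split: nat.split)
  then obtain r1 where r1: "strict_mono r1" "\<And>j. convergent (\<lambda>n. Y j (r1 n))"
    using diagonal_convergent[of Y] by blast
  obtain e where e: "(\<lambda>n. Q (r1 n)) \<longlonglongrightarrow> e" using r1(2)[of 0] by (auto simp: Y_simps convergent_def)
  obtain \<eta> where \<eta>: "(\<lambda>n. H (r1 n)) \<longlonglongrightarrow> \<eta>" using r1(2)[of "Suc 0"] by (auto simp: Y_simps convergent_def)
  have "\<forall>n. \<exists>l. (\<lambda>m. D n (r1 m)) \<longlonglongrightarrow> l"
    using r1(2)[of "Suc (Suc _)"] unfolding Y_simps convergent_def by blast
  then obtain L where L: "\<And>n. (\<lambda>m. D n (r1 m)) \<longlonglongrightarrow> L n" by metis
  have L_bdd: "0 \<le> L n $ i" "L n $ i \<le> sum.diam" for n i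
  proof -
    show "0 \<le> L n $ i"
      by (rule LIMSEQ_le_const[OF tendsto_vec_nth[OF L]]) (simp add: D_def)
    show "L n $ i \<le> sum.diam"
      by (rule LIMSEQ_le_const2[OF tendsto_vec_nth[OF L]]) (simp add: D_def comp_le z)
  qed
  have "bounded (range (\<lambda>n. L (r1 n)))"
    by (rule bounded_componentwise[where r = sum.diam]) (simp add: L_bdd)
  \<comment> \<open>A second extraction makes the row limits converge; the limits already obtained
    persist along it.\<close>
  then obtain \<delta> r2 where r2: "strict_mono r2" "(\<lambda>n. L (r1 (r2 n))) \<longlonglongrightarrow> \<delta>"
    using bounded_imp_convergent_subsequence unfolding comp_def by blast
  define r where "r = (\<lambda>n. r1 (r2 n))"
  have r: "strict_mono r" unfolding r_def using r1(1) r2(1) by (simp add: strict_mono_def)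
  have lim_e: "(\<lambda>n. Q (r n)) \<longlonglongrightarrow> e" and lim_\<eta>: "(\<lambda>n. H (r n)) \<longlonglongrightarrow> \<eta>"
    and lim_L: "(\<lambda>m. D n (r m)) \<longlonglongrightarrow> L n" and lim_\<delta>: "(\<lambda>n. L (r n)) \<longlonglongrightarrow> \<delta>" for n
    using LIMSEQ_subseq_LIMSEQ[OF e r2(1)] LIMSEQ_subseq_LIMSEQ[OF \<eta> r2(1)]
      LIMSEQ_subseq_LIMSEQ[OF L r2(1)] r2(2) by (simp_all add: r_def comp_def)
  define \<zeta> where "\<zeta> = ((\<chi> i. norm (u $ i - p $ i)) :: real^'n)"
  have \<delta>0: "0 \<le> \<delta> $ i" for i
    by (rule LIMSEQ_le_const[OF tendsto_vec_nth[OF lim_\<delta>]]) (simp add: L_bdd)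
  have e0: "0 \<le> e $ i" for i
    by (rule LIMSEQ_le_const[OF tendsto_vec_nth[OF lim_e]]) (simp add: Q_def)
  have zr: "norm.wconv (S i) (\<lambda>n. z (r n) $ i) (u $ i)" for i
    using norm.wconv_subseq[OF component_wconv[OF zu] r] by (simp add: comp_def)
  have x\<sigma>r: "strict_mono (\<lambda>n. \<sigma> (r n))" using \<sigma> r by (simp add: strict_mono_def)
  have xr: "norm.wconv (S i) (\<lambda>n. x (\<sigma> (r n)) $ i) (p $ i)" for i
    using norm.wconv_subseq[OF component_wconv[OF xp] x\<sigma>r] by (simp add: comp_def)
  have \<zeta>\<eta>: "\<zeta> $ i \<le> \<eta> $ i" for i
  proof (rule field_le_epsilon)
    fix t :: real assume t: "t > 0"
    have "(\<lambda>n. norm (z (r n) $ i - x (\<sigma> (r n)) $ i)) \<longlonglongrightarrow> \<eta> $ i"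
      using tendsto_vec_nth[OF lim_\<eta>, of i] by (simp add: H_def)
    then have "\<forall>\<^sub>F n in sequentially. norm (z (r n) $ i - x (\<sigma> (r n)) $ i) < \<eta> $ i + t"
      using t by (intro order_tendstoD(2)) auto
    then have "\<forall>\<^sub>F n in sequentially. norm (z (r n) $ i - x (\<sigma> (r n)) $ i) \<le> \<eta> $ i + t"
      by (rule eventually_mono) simp
    from norm.wconv_dist_le[OF zr xr this] show "\<zeta> $ i \<le> \<eta> $ i + t" by (simp add: \<zeta>_def)
  qed
  have e\<eta>: "\<bar>e $ i - c $ i\<bar> \<le> \<eta> $ i" for i
  proof (rule LIMSEQ_le)
    have "(\<lambda>n. norm (x (\<sigma> (r n)) $ i - p $ i)) \<longlonglongrightarrow> c $ i"
      using LIMSEQ_subseq_LIMSEQ[OF c x\<sigma>r] by (simp add: comp_def)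
    then show "(\<lambda>n. \<bar>Q (r n) $ i - norm (x (\<sigma> (r n)) $ i - p $ i)\<bar>) \<longlonglongrightarrow> \<bar>e $ i - c $ i\<bar>"
      by (intro tendsto_intros tendsto_vec_nth lim_e)
    show "(\<lambda>n. H (r n) $ i) \<longlonglongrightarrow> \<eta> $ i" by (intro tendsto_vec_nth lim_\<eta>)
    have "\<bar>norm (v - w) - norm (y - w)\<bar> \<le> norm (v - y)" for v w y :: 'a
      using norm_triangle_ineq3[of "v - w" "y - w"] by simp
    then show "\<exists>N. \<forall>n\<ge>N. \<bar>Q (r n) $ i - norm (x (\<sigma> (r n)) $ i - p $ i)\<bar> \<le> H (r n) $ i"
      by (simp add: Q_def H_def)
  qed
  have main: "e $ i \<le> \<delta> $ i + \<zeta> $ i - \<rho> i * min (\<delta> $ i) (\<zeta> $ i / (a i + 1))" for i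
  proof (rule field_le_epsilon)
    fix t :: real assume t: "t > 0"
    let ?\<mu> = "min (\<delta> $ i) (\<zeta> $ i / (a i + 1))"
    have \<zeta>0: "0 \<le> \<zeta> $ i" by (simp add: \<zeta>_def)
    have "\<forall>\<^sub>F n in sequentially. L (r n) $ i < \<delta> $ i + t"
      using t by (intro order_tendstoD(2)[OF tendsto_vec_nth[OF lim_\<delta>]]) simp
    then obtain n0 where n0: "\<And>n. n \<ge> n0 \<Longrightarrow> L (r n) $ i < \<delta> $ i + t"
      by (auto simp: eventually_sequentially)
    \<comment> \<open>Without its first \<open>n0\<close> terms the sequence has all row limits
      below \<open>\<delta> $ i + t\<close>. This bound is positive, as \<open>R_const_bound\<close>
      requires, even if \<open>\<delta> $ i = 0\<close>.\<close>
    define w where "w = (\<lambda>n. z (r (n + n0)) $ i - p $ i)"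
    have shift: "strict_mono (\<lambda>n. n + n0)" by (simp add: strict_mono_def)
    have zS: "z n $ i \<in> S i" for n using z sum.K_subset component_in by blast
    have pS: "p $ i \<in> S i" using p sum.K_subset component_in by blast
    have uS: "u $ i \<in> S i" using u component_in by blast
    have "e $ i \<le> (\<delta> $ i + t) + norm (u $ i - p $ i) - \<rho> i * ?\<mu>"
    proof (rule norm.R_const_bound[OF subspace_S R a])
      show "w n \<in> S i" for n unfolding w_def by (intro subspace_diff subspace_S zS pS)
      show "u $ i - p $ i \<in> S i" by (intro subspace_diff subspace_S uS pS)
      have "norm.wconv (S i) (\<lambda>n. z (r (n + n0)) $ i) (u $ i)"
        using norm.wconv_subseq[OF zr shift] by (simp add: comp_def)
      then show "norm.wconv (S i) w (u $ i - p $ i)"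
        unfolding w_def by (intro norm.wconv_diff_const subspace_S zS uS pS)
      show "0 < \<delta> $ i + t" using \<delta>0[of i] t by simp
      show "\<forall>\<^sub>F m in sequentially. norm (w n - w m) \<le> \<delta> $ i + t" for n
      proof -
        have "(\<lambda>m. D (r (n + n0)) (r (m + n0)) $ i) \<longlonglongrightarrow> L (r (n + n0)) $ i"
          using LIMSEQ_subseq_LIMSEQ[OF tendsto_vec_nth[OF lim_L] shift] by (simp add: comp_def)
        then have "\<forall>\<^sub>F m in sequentially. D (r (n + n0)) (r (m + n0)) $ i < \<delta> $ i + t"
          using n0[of "n + n0"] by (intro order_tendstoD(2)) auto
        then show ?thesis by (rule eventually_mono) (simp add: D_def w_def)
      qed
      show "0 \<le> ?\<mu>" using \<delta>0[of i] \<zeta>0 a[of i] by simp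
      show "?\<mu> \<le> \<delta> $ i + t" using t by simp
      have "a i * ?\<mu> \<le> a i * (\<zeta> $ i / (a i + 1))" using a[of i] by (intro mult_left_mono) auto
      also have "\<dots> \<le> \<zeta> $ i" using a[of i] \<zeta>0 by (simp add: divide_simps algebra_simps)
      finally show "a i * ?\<mu> \<le> norm (u $ i - p $ i)" by (simp add: \<zeta>_def)
      show "(\<lambda>n. norm (w n)) \<longlonglongrightarrow> e $ i"
        using LIMSEQ_subseq_LIMSEQ[OF tendsto_vec_nth[OF lim_e] shift]
        by (simp add: comp_def Q_def w_def)
    qed
    then show "e $ i \<le> \<delta> $ i + \<zeta> $ i - \<rho> i * ?\<mu> + t" by (simp add: \<zeta>_def)
  qed
  have "\<psi> (L n) \<le> \<tau>" for n
    by (rule LIMSEQ_le_const2[OF tendsto_psi[OF lim_L]]) (simp add: D_def psi_diff zz)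
  then have "\<psi> \<delta> \<le> \<tau>"
    by (intro LIMSEQ_le_const2[OF tendsto_psi[OF lim_\<delta>]]) simp
  moreover have "\<psi> \<eta> \<le> sum.diam - \<tau> + h"
    by (rule LIMSEQ_le_const2[OF tendsto_psi[OF lim_\<eta>]]) (simp add: H_def psi_diff zx)
  moreover have "sum.diam - h \<le> \<psi> e"
    by (rule LIMSEQ_le_const[OF tendsto_psi[OF lim_e]]) (simp add: Q_def psi_diff zp less_imp_le)
  moreover have "0 \<le> \<zeta> $ i" for i by (simp add: \<zeta>_def)
  ultimately show ?thesis using \<delta>0 e0 \<zeta>\<eta> e\<eta> main by blast
qed

lemma diam_zero: "sum.diam = 0"
proof (rule ccontr)
  assume "sum.diam \<noteq> 0"
  then have d: "0 < sum.diam" using sum.diam_nonneg by simp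
  obtain X p where X: "\<And>n. X n \<in> K" and p: "p \<in> K"
    and Xp: "sum.wconv (psi_sum_carrier S) X p"
    and Xafp: "(\<lambda>n. psi_sum_norm \<psi> (T (X n) - X n)) \<longlonglongrightarrow> 0"
    using sum.approximate_fixed_point_sequence by blast
  define Q where "Q = (\<lambda>n. (\<chi> i. norm (X n $ i - p $ i)) :: real^'n)"
  have "\<bar>Q n $ i\<bar> \<le> sum.diam" for n i
    using order_trans[OF component_diff_le sum.le_diam[OF X p]] by (simp add: Q_def)
  then have "bounded (range Q)" by (rule bounded_componentwise)
  \<comment> \<open>The vector \<open>c\<close> is fixed before \<open>\<tau>\<close>, so the values
    that \<open>\<tau>\<close> must avoid do not depend on it.\<close>
  then obtain \<sigma> c where \<sigma>: "strict_mono \<sigma>" and c: "(\<lambda>n. Q (\<sigma> n)) \<longlonglongrightarrow> c"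
    using bounded_imp_convergent_subsequence unfolding comp_def by blast
  define x where "x = (\<lambda>n. X (\<sigma> n))"
  have x: "x n \<in> K" for n by (simp add: x_def X)
  have xp: "sum.wconv (psi_sum_carrier S) x p"
    using sum.wconv_subseq[OF Xp \<sigma>] by (simp add: x_def comp_def)
  have afp: "(\<lambda>n. psi_sum_norm \<psi> (T (x n) - x n)) \<longlonglongrightarrow> 0"
    using LIMSEQ_subseq_LIMSEQ[OF Xafp \<sigma>] by (simp add: x_def comp_def)
  have ci: "(\<lambda>n. norm (x n $ i - p $ i)) \<longlonglongrightarrow> c $ i" for i
    using tendsto_vec_nth[OF c, of i] by (simp add: Q_def x_def)
  \<comment> \<open>There are only finitely many sets \<open>A\<close> of coordinates, while the
    interval is infinite because \<open>diam\<close> is positive.\<close>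
  have "infinite ({0<..<sum.diam} - range (\<lambda>A. \<psi> (\<chi> i. if i \<in> A then c $ i else 0)))"
    using d by (intro Diff_infinite_finite) auto
  then have "\<exists>\<tau>. \<tau> \<in> {0<..<sum.diam} - range (\<lambda>A. \<psi> (\<chi> i. if i \<in> A then c $ i else 0))"
    using infinite_imp_nonempty by (simp only: ex_in_conv)
  then obtain \<tau> where \<tau>: "0 < \<tau>" "\<tau> < sum.diam"
    and \<tau>_notin: "\<tau> \<notin> range (\<lambda>A. \<psi> (\<chi> i. if i \<in> A then c $ i else 0))"
    unfolding Diff_iff greaterThanLessThan_iff by blast
  have "\<forall>k::nat. \<exists>\<delta> \<zeta> \<eta> e :: real^'n.
    (\<forall>i. 0 \<le> \<delta> $ i \<and> 0 \<le> \<zeta> $ i \<and> 0 \<le> e $ i \<and> \<zeta> $ i \<le> \<eta> $ i \<and> \<bar>e $ i - c $ i\<bar> \<le> \<eta> $ i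
      \<and> e $ i \<le> \<delta> $ i + \<zeta> $ i - \<rho> i * min (\<delta> $ i) (\<zeta> $ i / (a i + 1)))
    \<and> \<psi> \<eta> \<le> sum.diam - \<tau> + inverse (real (Suc k)) \<and> \<psi> \<delta> \<le> \<tau>
    \<and> sum.diam - inverse (real (Suc k)) \<le> \<psi> e"
    using \<tau> by (intro allI component_estimates[OF x p xp afp ci _ _ d]) auto
  then obtain \<delta> \<zeta> \<eta> e :: "nat \<Rightarrow> real^'n" where est: "\<And>k. (\<forall>i. 0 \<le> \<delta> k $ i \<and> 0 \<le> \<zeta> k $ i
      \<and> 0 \<le> e k $ i \<and> \<zeta> k $ i \<le> \<eta> k $ i \<and> \<bar>e k $ i - c $ i\<bar> \<le> \<eta> k $ i
      \<and> e k $ i \<le> \<delta> k $ i + \<zeta> k $ i - \<rho> i * min (\<delta> k $ i) (\<zeta> k $ i / (a i + 1)))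
    \<and> \<psi> (\<eta> k) \<le> sum.diam - \<tau> + inverse (real (Suc k)) \<and> \<psi> (\<delta> k) \<le> \<tau>
    \<and> sum.diam - inverse (real (Suc k)) \<le> \<psi> (e k)"
    by metis
  have "\<exists>A. \<psi> (\<chi> i. if i \<in> A then c $ i else 0) = \<tau>"
    by (rule extremal_components_limit[where \<delta> = \<delta> and \<zeta> = \<zeta> and \<eta> = \<eta> and e = e and d = sum.diam, OF a \<rho>])
      (use est in blast)+
  then show False using \<tau>_notin by blast
qed

end

theorem theorem3p4:
  fixes S :: "'n::finite \<Rightarrow> 'a::banach set"
    and \<psi> :: "real^'n \<Rightarrow> real"
  assumes "\<And>i. subspace (S i)" and "\<And>i. closed (S i)"
    and "\<And>i. M_const (S i) norm > 1"
    and "is_norm_on_Rn \<psi>" and "absolute_norm \<psi>" and "normalized_norm \<psi>"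
    and "strictly_monotone_norm \<psi>"
  shows "WFPP (psi_sum_carrier S) (psi_sum_norm \<psi>)"
  unfolding WFPP_def
proof (intro allI impI, elim conjE)
  fix C :: "('a^'n) set" and T :: "'a^'n \<Rightarrow> 'a^'n"
  assume C: "C \<noteq> {}" "convex C" "weakly_compact (psi_sum_carrier S) (psi_sum_norm \<psi>) C"
    "T ` C \<subseteq> C" "nonexpansive_on C (psi_sum_norm \<psi>) T"
  have \<psi>: "strictly_monotone_absolute_norm \<psi>"
    using assms(4-7) by unfold_locales
  interpret wc: weakly_compact_set "psi_sum_norm \<psi>" "psi_sum_carrier S" C
    by (intro weakly_compact_set.intro weakly_compact_set_axioms.intro C
        strictly_monotone_absolute_norm.norm_fun_psi_sum[OF \<psi>])
  obtain K where K: "K \<noteq> {}" "convex K" "closedin wc.W K" "T ` K \<subseteq> K"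
    "\<And>L. L \<subseteq> K \<Longrightarrow> L \<noteq> {} \<Longrightarrow> convex L \<Longrightarrow> closedin wc.W L \<Longrightarrow> T ` L \<subseteq> L \<Longrightarrow> L = K"
    using wc.minimal_invariant_exists[OF C(1,4)] by blast
  have KC: "K \<subseteq> C" using closedin_subset[OF K(3)] by (simp add: wc.topspace_W)
  have "\<forall>i. \<exists>a \<rho>. 0 \<le> a \<and> 0 < \<rho> \<and> R_const a (S i) norm \<le> ereal (1 + a - \<rho>)"
    using norm.M_const_gt_1D assms(1,3) subspace_0 by blast
  then obtain a \<rho> where a\<rho>: "\<And>i. 0 \<le> a i" "\<And>i. 0 < \<rho> i"
    "\<And>i. R_const (a i) (S i) norm \<le> ereal (1 + a i - \<rho> i)" by metis
  interpret strictly_monotone_absolute_norm \<psi> by (rule \<psi>)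
  interpret minimal_invariant_sum \<psi> S C T K a \<rho>
  proof unfold_locales
    show "psi_sum_norm \<psi> (T x - T y) \<le> psi_sum_norm \<psi> (x - y)" if "x \<in> K" "y \<in> K" for x y
      using C(5) that KC unfolding nonexpansive_on_def by blast
  qed (use K a\<rho> assms(1) in auto)
  \<comment> \<open>Diameter zero reduces \<open>K\<close> to a single point, which invariance
    forces to be fixed.\<close>
  obtain x where x: "x \<in> K" using K(1) by blast
  have "psi_sum_norm \<psi> (T x - x) = 0"
    using sum.le_diam[OF sum.T_in[OF x] x] diam_zero wc.N_nonneg[of "T x - x"] by simp
  then have "T x = x" using wc.N_eq_0[of "T x - x"] by simp
  then show "\<exists>x\<in>C. T x = x" using x KC by blast
qed

end
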